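(* Let $G$ be a countable abelian group, $P$ a semigroup with identity $e$, $\theta$ an action of $P$ on $G$ by injective group homomorphisms, $A=C^*(G)$, and let $X=\bigsqcup_{p\in P}X_p$, $X_p=A\mathbbm{1}_p$, be the associated product system. Let $\xi:P\times P\to A_{\mathrm{sa}}$ be a normalized $2$-cocycle with self-adjoint values, i.e. $\xi(p,q)=0$ if $p=e$ or $q=e$, and $$\theta_p(\xi(q,r))-\xi(pq,r)+\xi(p,qr)-\xi(p,q)=0\qquad(p,q,r\in P).$$ Let $X^\xi=\bigsqcup_{p\in P}X^\xi_p$, where $X^\xi_p$ coincides with $X_p$ as a right Hilbert $A$–$A$-bimodule (its generator being denoted $\mathbbm{1}_p^\xi$), with multiplication between fibers $$(a\mathbbm{1}_p^\xi)(b\mathbbm{1}_q^\xi):=\exp(i\xi(p,q))\,a\theta_p(b)\mathbbm{1}_{pq}^\xi .$$ Then $X^\xi$ is a product system over $P$ with coefficients in $A$.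
   Context: A product system over $P$ with coefficients in a $C^*$-algebra $A$ is a disjoint union $X=\bigsqcup_{p\in P}X_p$ such that: (PS1) for $p\ne e$, $X_p$ is a right Hilbert $A$–$A$-bimodule ($C^*$-correspondence over $A$); (PS2) $X_e$ is the standard bimodule ${}_AA_A$ with $\langle a,b\rangle=a^*b$; (PS3) $X$ is a semigroup with $xy\in X_{pq}$ for $x\in X_p,y\in X_q$, and for $p,q\ne e$ this product extends to an isomorphism $X_p\otimes_AX_q\to X_{pq}$ of right Hilbert $A$–$A$-bimodules; if $p$ or $q$ equals $e$, the product is given by the left or right action of $A$, respectively. An action $\theta$ means $\theta_{pq}=\theta_p\theta_q$, $\theta_e=\mathrm{id}$; $\theta_p$ also denotes the induced injective $*$-endomorphism of $A=C^*(G)$. The product system $X$ associated with $(G,P,\theta)$: $X_p$ is the free left $A$-module of rank one with basis element $\mathbbm{1}_p$, right action $\mathbbm{1}_pa=\theta_p(a)\mathbbm{1}_p$, inner product $\langle a\mathbbm{1}_p,b\mathbbm{1}_p\rangle_p=\theta_p^{-1}(E_p(a^*b))$, where $E_p:C^*(G)\to C^*(\theta_p(G))$ is the conditional expectation given by restriction, and multiplication $(a\mathbbm{1}_p)(b\mathbbm{1}_q)=a\theta_p(b)\mathbbm{1}_{pq}$. It is a standing assumption that this $X$ is a product system (in particular that each $X_p$ is a complete Hilbert module). $A_{\mathrm{sa}}$ denotes the self-adjoint elements of $A$. *)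

theory Defs
  imports "HOL-Analysis.Analysis" "HOL-Library.Poly_Mapping"
begin

section \<open>Unital C*-algebras\<close>

class cstar_algebra = real_normed_algebra_1 + banach +
  fixes scaleC :: "complex \<Rightarrow> 'a \<Rightarrow> 'a"  (infixr \<open>*\<^sub>C\<close> 75)
    and star :: "'a \<Rightarrow> 'a"
  assumes scaleC_of_real: "complex_of_real r *\<^sub>C x = r *\<^sub>R x"
    and scaleC_add_left: "(c + d) *\<^sub>C x = c *\<^sub>C x + d *\<^sub>C x"
    and scaleC_add_right: "c *\<^sub>C (x + y) = c *\<^sub>C x + c *\<^sub>C y"
    and scaleC_scaleC: "c *\<^sub>C d *\<^sub>C x = (c * d) *\<^sub>C x"
    and scaleC_mult_left: "(c *\<^sub>C x) * y = c *\<^sub>C (x * y)"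
    and scaleC_mult_right: "x * (c *\<^sub>C y) = c *\<^sub>C (x * y)"
    and norm_scaleC: "norm (c *\<^sub>C x) = cmod c * norm x"
    and star_star: "star (star x) = x"
    and star_add: "star (x + y) = star x + star y"
    and star_scaleC: "star (c *\<^sub>C x) = cnj c *\<^sub>C star x"
    and star_mult: "star (x * y) = star y * star x"
    and norm_star_mult: "norm (star x * x) = (norm x)\<^sup>2"

definition self_adjoint :: "'a::cstar_algebra \<Rightarrow> bool"
  where "self_adjoint a \<longleftrightarrow> star a = a"

definition cstar_nonneg :: "'a::cstar_algebra \<Rightarrow> bool"
  where "cstar_nonneg a \<longleftrightarrow> (\<exists>b. a = star b * b)"

definition bounded_clinear :: "('a::cstar_algebra \<Rightarrow> 'b::cstar_algebra) \<Rightarrow> bool"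
  where "bounded_clinear f \<longleftrightarrow> bounded_linear f \<and> (\<forall>c x. f (c *\<^sub>C x) = c *\<^sub>C f x)"

definition star_hom :: "('a::cstar_algebra \<Rightarrow> 'b::cstar_algebra) \<Rightarrow> bool"
  where "star_hom f \<longleftrightarrow> bounded_clinear f \<and> (\<forall>x y. f (x * y) = f x * f y) \<and> (\<forall>x. f (star x) = star (f x))"


section \<open>The group algebra and its maximal C*-seminorm\<close>

text \<open>For an additively written abelian group \<open>'g\<close>, the type \<open>'g \<Rightarrow>\<^sub>0 complex\<close> with the
  convolution product of the library is the complex group algebra.\<close>

definition ga_scale :: "complex \<Rightarrow> ('g::ab_group_add \<Rightarrow>\<^sub>0 complex) \<Rightarrow> ('g \<Rightarrow>\<^sub>0 complex)"
  where "ga_scale c f = Poly_Mapping.map ((*) c) f"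

definition ga_star :: "('g::ab_group_add \<Rightarrow>\<^sub>0 complex) \<Rightarrow> ('g \<Rightarrow>\<^sub>0 complex)"
  where "ga_star f = Poly_Mapping.map cnj (Poly_Mapping.map_key uminus f)"

definition cstar_seminorm :: "(('g::ab_group_add \<Rightarrow>\<^sub>0 complex) \<Rightarrow> real) \<Rightarrow> bool"
  where "cstar_seminorm N \<longleftrightarrow>
    (\<forall>f h. N (f + h) \<le> N f + N h) \<and> (\<forall>c f. N (ga_scale c f) = cmod c * N f) \<and>
    (\<forall>f h. N (f * h) \<le> N f * N h) \<and> (\<forall>f. N (ga_star f * f) = (N f)\<^sup>2)"

definition ga_norm :: "('g::ab_group_add \<Rightarrow>\<^sub>0 complex) \<Rightarrow> real"
  where "ga_norm f = (SUP N\<in>Collect cstar_seminorm. N f)"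

lemma ga_scale_eq: "ga_scale c f = Poly_Mapping.single 0 c * f"
  by (simp add: ga_scale_def mult_map_scale_conv_mult)

lemma ga_scale_simps:
  "ga_scale 1 f = f"
  "ga_scale (c + d) f = ga_scale c f + ga_scale d f"
  "ga_scale c (f + h) = ga_scale c f + ga_scale c h"
  "ga_scale c (ga_scale d f) = ga_scale (c * d) f"
  "ga_scale c f * h = ga_scale c (f * h)"
  "f * ga_scale c h = ga_scale c (f * h)"
  by (simp_all add: ga_scale_eq single_add distrib_left distrib_right mult_single
      mult.assoc[symmetric] mult.commute[of f])

lemma lookup_ga_star: "Poly_Mapping.lookup (ga_star f) g = cnj (Poly_Mapping.lookup f (- g))"
proof -
  have "inj (uminus :: 'a \<Rightarrow> 'a)" by (simp add: inj_on_def)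
  then show ?thesis
    by (simp add: ga_star_def Poly_Mapping.map.rep_eq Poly_Mapping.map_key.rep_eq when_def)
qed

lemma ga_decomp: "f = (\<Sum>g\<in>Poly_Mapping.keys f. Poly_Mapping.single g (Poly_Mapping.lookup f g))"
proof (rule poly_mapping_eqI)
  fix k
  show "Poly_Mapping.lookup f k = Poly_Mapping.lookup (\<Sum>g\<in>Poly_Mapping.keys f. Poly_Mapping.single g (Poly_Mapping.lookup f g)) k"
    by (auto simp: lookup_sum lookup_single when_def in_keys_iff)
qed

lemma ga_induct [case_names zero single add]:
  assumes "P 0" "\<And>g c. P (Poly_Mapping.single g c)" "\<And>a b. P a \<Longrightarrow> P b \<Longrightarrow> P (a + b)"
  shows "P (f :: 'g \<Rightarrow>\<^sub>0 complex)"
proof -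
  have "P (\<Sum>g\<in>S. Poly_Mapping.single g (Poly_Mapping.lookup f g))" if "finite S" for S
    using that by (induction) (auto intro: assms)
  then show ?thesis using ga_decomp[of f] by (metis finite_keys)
qed

lemma ga_star_add: "ga_star (f + h) = ga_star f + ga_star h"
  by (rule poly_mapping_eqI) (simp add: lookup_ga_star lookup_add)

lemma ga_star_zero: "ga_star 0 = 0"
  by (rule poly_mapping_eqI) (simp add: lookup_ga_star)

lemma ga_star_single: "ga_star (Poly_Mapping.single g c) = Poly_Mapping.single (- g) (cnj c)"
  by (rule poly_mapping_eqI) (auto simp add: lookup_ga_star lookup_single when_def)

lemma ga_star_star: "ga_star (ga_star f) = f"
  by (rule poly_mapping_eqI) (simp add: lookup_ga_star)

lemma ga_star_mult: "ga_star (f * h) = ga_star h * ga_star f"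
proof (induction f rule: ga_induct)
  case (single g c)
  then show ?case
    by (induction h rule: ga_induct)
       (simp_all add: ga_star_zero ga_star_single ga_star_add mult_single algebra_simps)
qed (simp_all add: ga_star_zero ga_star_add algebra_simps)

lemma ga_star_scale: "ga_star (ga_scale c f) = ga_scale (cnj c) (ga_star f)"
  by (simp add: ga_scale_eq ga_star_mult ga_star_single mult.commute)

lemma ga_star_one: "ga_star 1 = 1"
  using ga_star_single[of 0 1] by simp

context
  fixes N :: "('g::ab_group_add \<Rightarrow>\<^sub>0 complex) \<Rightarrow> real"
  assumes N: "cstar_seminorm N"
begin

lemma csn_add: "N (f + h) \<le> N f + N h"
  and csn_scale: "N (ga_scale c f) = cmod c * N f"
  and csn_mult: "N (f * h) \<le> N f * N h"
  and csn_star: "N (ga_star f * f) = (N f)\<^sup>2"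
  using N by (auto simp: cstar_seminorm_def)

lemma csn_zero: "N 0 = 0"
  using csn_scale[of 0 0] by (simp add: ga_scale_eq)

lemma csn_nonneg: "N f \<ge> 0"
proof -
  have "ga_scale (-1) f = - f" by (simp add: ga_scale_eq single_uminus)
  then have "N (- f) = N f" using csn_scale[of "-1" f] by simp
  then show ?thesis using csn_add[of f "- f"] csn_zero by simp
qed

lemma csn_single: "N (Poly_Mapping.single g c) \<le> cmod c"
proof -
  have one: "N 1 \<le> 1"
    using csn_star[of 1] csn_nonneg[of 1]
    by (auto simp: ga_star_one power2_eq_square)
  have "(N (Poly_Mapping.single g 1))\<^sup>2 = N 1"
    using csn_star[of "Poly_Mapping.single g 1"] by (simp add: ga_star_single mult_single)
  with one have "N (Poly_Mapping.single g 1) \<le> 1"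
    by (metis abs_square_le_1 abs_of_nonneg csn_nonneg)
  moreover have "Poly_Mapping.single g c = ga_scale c (Poly_Mapping.single g 1)"
    by (simp add: ga_scale_eq mult_single)
  ultimately show ?thesis using csn_scale by (simp add: mult_left_le)
qed

lemma csn_bound: "N f \<le> (\<Sum>g\<in>Poly_Mapping.keys f. cmod (Poly_Mapping.lookup f g))"
proof -
  have "N (\<Sum>g\<in>S. Poly_Mapping.single g (Poly_Mapping.lookup f g)) \<le> (\<Sum>g\<in>S. cmod (Poly_Mapping.lookup f g))" if "finite S" for S
    using that
  proof (induction)
    case (insert x F)
    then show ?case
      using csn_add[of "Poly_Mapping.single x (Poly_Mapping.lookup f x)" "\<Sum>g\<in>F. Poly_Mapping.single g (Poly_Mapping.lookup f g)"]
        csn_single[of x "Poly_Mapping.lookup f x"] by simp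
  qed (simp add: csn_zero)
  then show ?thesis using ga_decomp[of f] by (metis finite_keys)
qed

end

text \<open>The trivial character gives a nonzero C*-seminorm.\<close>

lemma trivial_csn:
  "cstar_seminorm (\<lambda>f :: 'g::ab_group_add \<Rightarrow>\<^sub>0 complex. cmod (\<Sum>g\<in>Poly_Mapping.keys f. Poly_Mapping.lookup f g))"
proof -
  define s :: "('g \<Rightarrow>\<^sub>0 complex) \<Rightarrow> complex" where "s f = (\<Sum>g\<in>Poly_Mapping.keys f. Poly_Mapping.lookup f g)" for f
  have s_eq: "s f = (\<Sum>g\<in>S. Poly_Mapping.lookup f g)" if "finite S" "Poly_Mapping.keys f \<subseteq> S" for f S
    unfolding s_def by (rule sum.mono_neutral_left) (use that in \<open>auto simp: in_keys_iff\<close>)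
  have s_zero: "s 0 = 0" by (simp add: s_def)
  have s_add: "s (f + h) = s f + s h" for f h
  proof -
    have "s (f + h) = (\<Sum>g\<in>Poly_Mapping.keys f \<union> Poly_Mapping.keys h. Poly_Mapping.lookup (f + h) g)"
      by (rule s_eq) (simp_all add: Poly_Mapping.keys_add)
    also have "\<dots> = s f + s h"
      by (simp add: lookup_add sum.distrib s_eq[of "Poly_Mapping.keys f \<union> Poly_Mapping.keys h" f] s_eq[of "Poly_Mapping.keys f \<union> Poly_Mapping.keys h" h])
    finally show ?thesis .
  qed
  have s_single: "s (Poly_Mapping.single g c) = c" for g c
    using s_eq[of "{g}" "Poly_Mapping.single g c"] by (auto split: if_splits)
  have s_mult: "s (f * h) = s f * s h" for f h
  proof (induction f rule: ga_induct)
    case (single g c)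
    show ?case
      by (induction h rule: ga_induct) (simp_all add: s_zero s_single s_add mult_single algebra_simps)
  qed (simp_all add: s_zero s_add algebra_simps)
  have s_star: "s (ga_star f) = cnj (s f)" for f
    by (induction f rule: ga_induct) (simp_all add: s_zero ga_star_zero ga_star_single s_single s_add ga_star_add)
  show ?thesis
    unfolding cstar_seminorm_def s_def[symmetric]
    by (auto simp: s_add s_mult s_star norm_mult power2_eq_square norm_triangle_ineq ga_scale_eq s_single)
qed

lemma csn_nonempty: "Collect cstar_seminorm \<noteq> {}"
  using trivial_csn by blast

lemma csn_bdd: "bdd_above ((\<lambda>N. N f) ` Collect cstar_seminorm)"
  by (rule bdd_aboveI[of _ "\<Sum>g\<in>Poly_Mapping.keys f. cmod (Poly_Mapping.lookup f g)"]) (auto intro: csn_bound)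

lemma ga_norm_upper: "cstar_seminorm N \<Longrightarrow> N f \<le> ga_norm f"
  unfolding ga_norm_def by (rule cSUP_upper2[OF csn_bdd]) auto

lemma ga_norm_least: "(\<And>N. cstar_seminorm N \<Longrightarrow> N f \<le> b) \<Longrightarrow> ga_norm f \<le> b"
  unfolding ga_norm_def by (rule cSUP_least[OF csn_nonempty]) auto

lemma ga_norm_nonneg: "ga_norm f \<ge> 0"
  using ga_norm_upper[OF trivial_csn, of f] by (meson norm_ge_zero order_trans)

lemma cstar_seminorm_ga_norm: "cstar_seminorm (ga_norm :: ('g::ab_group_add \<Rightarrow>\<^sub>0 complex) \<Rightarrow> real)"
  unfolding cstar_seminorm_def
proof (intro conjI allI)
  fix f h :: "'g \<Rightarrow>\<^sub>0 complex" and c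
  show "ga_norm (f + h) \<le> ga_norm f + ga_norm h"
    by (rule ga_norm_least) (meson add_mono csn_add ga_norm_upper order_trans)
  show "ga_norm (f * h) \<le> ga_norm f * ga_norm h"
    by (rule ga_norm_least)
       (meson csn_mult csn_nonneg ga_norm_nonneg ga_norm_upper mult_mono order_trans)
  have le: "ga_norm (ga_scale c f) \<le> cmod c * ga_norm f" for c f
    by (rule ga_norm_least) (simp add: csn_scale mult_left_mono ga_norm_upper)
  show "ga_norm (ga_scale c f) = cmod c * ga_norm f"
  proof (cases "c = 0")
    case True
    then show ?thesis using le[of 0 f] ga_norm_nonneg[of "ga_scale 0 f"] by simp
  next
    case False
    have "ga_scale (inverse c) (ga_scale c f) = f"
      using False by (simp add: ga_scale_eq mult.assoc[symmetric] mult_single)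
    then have "ga_norm f \<le> inverse (cmod c) * ga_norm (ga_scale c f)"
      using le[of "inverse c" "ga_scale c f"] by (simp add: norm_inverse)
    with False have "cmod c * ga_norm f \<le> ga_norm (ga_scale c f)"
      by (simp add: field_simps)
    with le[of c f] show ?thesis by simp
  qed
  show "ga_norm (ga_star f * f) = (ga_norm f)\<^sup>2"
  proof (rule antisym)
    show "ga_norm (ga_star f * f) \<le> (ga_norm f)\<^sup>2"
      by (rule ga_norm_least) (simp add: csn_star csn_nonneg ga_norm_upper power_mono)
    have "ga_norm f \<le> sqrt (ga_norm (ga_star f * f))"
    proof (rule ga_norm_least)
      fix N :: "('g \<Rightarrow>\<^sub>0 complex) \<Rightarrow> real" assume N: "cstar_seminorm N"
      have "(N f)\<^sup>2 \<le> ga_norm (ga_star f * f)"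
        using ga_norm_upper[OF N, of "ga_star f * f"] csn_star[OF N, of f] by simp
      then show "N f \<le> sqrt (ga_norm (ga_star f * f))"
        by (rule real_le_rsqrt)
    qed
    then show "(ga_norm f)\<^sup>2 \<le> ga_norm (ga_star f * f)"
      using power_mono[OF _ ga_norm_nonneg, of f _ 2] ga_norm_nonneg[of "ga_star f * f"]
      by (metis real_sqrt_pow2)
  qed
qed

lemmas ga_norm_add = csn_add[OF cstar_seminorm_ga_norm]
  and ga_norm_scale = csn_scale[OF cstar_seminorm_ga_norm]
  and ga_norm_mult = csn_mult[OF cstar_seminorm_ga_norm]
  and ga_norm_star_mult = csn_star[OF cstar_seminorm_ga_norm]
  and ga_norm_zero = csn_zero[OF cstar_seminorm_ga_norm]

lemma ga_norm_minus: "ga_norm (- f) = ga_norm f"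
  using ga_norm_scale[of "-1" f] by (simp add: ga_scale_eq single_uminus)

lemma ga_norm_minus_commute: "ga_norm (f - h) = ga_norm (h - f)"
  using ga_norm_minus[of "f - h"] by simp

lemma ga_norm_triangle: "ga_norm (f - h) \<le> ga_norm (f - k) + ga_norm (k - h)"
  using ga_norm_add[of "f - k" "k - h"] by simp

lemma ga_norm_diff_abs: "\<bar>ga_norm f - ga_norm h\<bar> \<le> ga_norm (f - h)"
  using ga_norm_add[of "f - h" h] ga_norm_add[of "h - f" f] ga_norm_minus_commute[of f h] by simp

lemma ga_norm_one: "ga_norm (1 :: 'g::ab_group_add \<Rightarrow>\<^sub>0 complex) = 1"
proof (rule antisym)
  show "ga_norm (1 :: 'g \<Rightarrow>\<^sub>0 complex) \<le> 1"
    using csn_single[OF cstar_seminorm_ga_norm, of 0 1] by simp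
  show "1 \<le> ga_norm (1 :: 'g \<Rightarrow>\<^sub>0 complex)"
    using ga_norm_upper[OF trivial_csn, of "1 :: 'g \<Rightarrow>\<^sub>0 complex"] by simp
qed

lemma ga_norm_star: "ga_norm (ga_star f) = ga_norm f"
proof -
  have le: "ga_norm f \<le> ga_norm (ga_star f)" for f :: "'a \<Rightarrow>\<^sub>0 complex"
  proof (cases "ga_norm f = 0")
    case False
    then have "ga_norm f > 0" using ga_norm_nonneg[of f] by simp
    then show ?thesis
      using ga_norm_star_mult[of f] ga_norm_mult[of "ga_star f" f] by (simp add: power2_eq_square)
  qed (simp add: ga_norm_nonneg)
  show ?thesis using le[of f] le[of "ga_star f"] by (simp add: ga_star_star)
qed


section \<open>The group C*-algebra\<close>

text \<open>The type \<open>'g group_cstar\<close> is the completion of the group algebra in its maximal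
  C*-seminorm: Cauchy sequences modulo null sequences.\<close>

definition ga_cauchy :: "(nat \<Rightarrow> ('g::ab_group_add \<Rightarrow>\<^sub>0 complex)) \<Rightarrow> bool"
  where "ga_cauchy S \<longleftrightarrow> (\<forall>e>0. \<exists>M. \<forall>m\<ge>M. \<forall>n\<ge>M. ga_norm (S m - S n) < e)"

definition ga_rel :: "(nat \<Rightarrow> ('g::ab_group_add \<Rightarrow>\<^sub>0 complex)) \<Rightarrow> (nat \<Rightarrow> ('g \<Rightarrow>\<^sub>0 complex)) \<Rightarrow> bool"
  where "ga_rel S T \<longleftrightarrow> ga_cauchy S \<and> ga_cauchy T \<and> (\<lambda>n. ga_norm (S n - T n)) \<longlonglongrightarrow> 0"

lemma ga_null_le:
  assumes "X \<longlonglongrightarrow> 0" "\<And>n. ga_norm (F n) \<le> X n"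
  shows "(\<lambda>n. ga_norm (F n)) \<longlonglongrightarrow> 0"
  by (rule tendsto_sandwich[OF _ _ tendsto_const assms(1)])
     (auto intro: always_eventually simp: ga_norm_nonneg assms(2))

lemma ga_cauchy_le:
  assumes "ga_cauchy S" "K \<ge> 0" "\<And>m n. ga_norm (T m - T n) \<le> K * ga_norm (S m - S n)"
  shows "ga_cauchy T"
  unfolding ga_cauchy_def
proof (intro allI impI)
  fix e :: real assume "e > 0"
  then have "e / (K + 1) > 0" using assms(2) by simp
  then obtain M where M: "ga_norm (S m - S n) < e / (K + 1)" if "m \<ge> M" "n \<ge> M" for m n
    using assms(1) unfolding ga_cauchy_def by meson
  have "ga_norm (T m - T n) < e" if "m \<ge> M" "n \<ge> M" for m n
  proof -
    have "ga_norm (T m - T n) \<le> (K + 1) * ga_norm (S m - S n)"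
      using assms(3)[of m n] ga_norm_nonneg[of "S m - S n"] by (simp add: algebra_simps)
    also have "\<dots> < (K + 1) * (e / (K + 1))"
      by (rule mult_strict_left_mono[OF M[OF that]]) (use assms(2) in simp)
    finally show ?thesis using assms(2) by simp
  qed
  then show "\<exists>M. \<forall>m\<ge>M. \<forall>n\<ge>M. ga_norm (T m - T n) < e" by blast
qed

lemma ga_cauchy_const: "ga_cauchy (\<lambda>_. f)"
  by (simp add: ga_cauchy_def ga_norm_zero)

lemma ga_cauchy_bounded:
  assumes "ga_cauchy S" shows "\<exists>B\<ge>0. \<forall>n. ga_norm (S n) \<le> B"
proof -
  obtain M where M: "ga_norm (S m - S n) < 1" if "m \<ge> M" "n \<ge> M" for m n
    using assms unfolding ga_cauchy_def by (meson zero_less_one)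
  define B where "B = (\<Sum>k\<le>M. ga_norm (S k)) + 1"
  have le: "ga_norm (S n) \<le> B" for n
  proof (cases "n \<le> M")
    case True
    then have "ga_norm (S n) \<le> (\<Sum>k\<le>M. ga_norm (S k))"
      by (intro member_le_sum) (auto simp: ga_norm_nonneg)
    then show ?thesis by (simp add: B_def)
  next
    case False
    then have "ga_norm (S n - S M) < 1" by (intro M) auto
    moreover have "ga_norm (S n) \<le> ga_norm (S n - S M) + ga_norm (S M)"
      using ga_norm_add[of "S n - S M" "S M"] by simp
    moreover have "ga_norm (S M) \<le> (\<Sum>k\<le>M. ga_norm (S k))"
      by (intro member_le_sum) (auto simp: ga_norm_nonneg)
    ultimately show ?thesis by (simp add: B_def)
  qed
  have "B \<ge> 0" using le[of 0] ga_norm_nonneg[of "S 0"] by linarith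
  then show ?thesis using le by blast
qed

lemma ga_cauchy_add:
  assumes "ga_cauchy S" "ga_cauchy T"
  shows "ga_cauchy (\<lambda>n. S n + T n)"
  unfolding ga_cauchy_def
proof (intro allI impI)
  fix e :: real assume e: "e > 0"
  obtain M1 where M1: "ga_norm (S m - S n) < e / 2" if "m \<ge> M1" "n \<ge> M1" for m n
    using assms(1) e unfolding ga_cauchy_def by (meson half_gt_zero)
  obtain M2 where M2: "ga_norm (T m - T n) < e / 2" if "m \<ge> M2" "n \<ge> M2" for m n
    using assms(2) e unfolding ga_cauchy_def by (meson half_gt_zero)
  have "ga_norm (S m + T m - (S n + T n)) < e" if "m \<ge> max M1 M2" "n \<ge> max M1 M2" for m n
  proof -
    have "ga_norm (S m + T m - (S n + T n)) \<le> ga_norm (S m - S n) + ga_norm (T m - T n)"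
      using ga_norm_add[of "S m - S n" "T m - T n"] by (simp add: algebra_simps)
    then show ?thesis using M1[of m n] M2[of m n] that by simp
  qed
  then show "\<exists>M. \<forall>m\<ge>M. \<forall>n\<ge>M. ga_norm (S m + T m - (S n + T n)) < e" by blast
qed

lemma ga_mult_diff_le: "ga_norm (a * b - c * d) \<le> ga_norm a * ga_norm (b - d) + ga_norm (a - c) * ga_norm d"
proof -
  have "a * b - c * d = a * (b - d) + (a - c) * d" by (simp add: algebra_simps)
  then have "ga_norm (a * b - c * d) \<le> ga_norm (a * (b - d)) + ga_norm ((a - c) * d)"
    using ga_norm_add[of "a * (b - d)" "(a - c) * d"] by simp
  also have "\<dots> \<le> ga_norm a * ga_norm (b - d) + ga_norm (a - c) * ga_norm d"
    by (intro add_mono ga_norm_mult)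
  finally show ?thesis .
qed

lemma ga_cauchy_mult:
  assumes "ga_cauchy S" "ga_cauchy T"
  shows "ga_cauchy (\<lambda>n. S n * T n)"
  unfolding ga_cauchy_def
proof (intro allI impI)
  fix e :: real assume e: "e > 0"
  obtain B where B: "B \<ge> 0" "\<And>n. ga_norm (S n) \<le> B"
    using ga_cauchy_bounded[OF assms(1)] by blast
  obtain C where C: "C \<ge> 0" "\<And>n. ga_norm (T n) \<le> C"
    using ga_cauchy_bounded[OF assms(2)] by blast
  define d where "d = e / (B + C + 1)"
  have d: "d > 0" using e B(1) C(1) by (simp add: d_def)
  obtain M1 where M1: "ga_norm (S m - S n) < d" if "m \<ge> M1" "n \<ge> M1" for m n
    using assms(1) d unfolding ga_cauchy_def by meson
  obtain M2 where M2: "ga_norm (T m - T n) < d" if "m \<ge> M2" "n \<ge> M2" for m n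
    using assms(2) d unfolding ga_cauchy_def by meson
  have "ga_norm (S m * T m - S n * T n) < e" if "m \<ge> max M1 M2" "n \<ge> max M1 M2" for m n
  proof -
    have "ga_norm (S m * T m - S n * T n) \<le> ga_norm (S m) * ga_norm (T m - T n) + ga_norm (S m - S n) * ga_norm (T n)"
      by (rule ga_mult_diff_le)
    also have "\<dots> \<le> B * d + d * C"
      by (intro add_mono mult_mono) (use M1[of m n] M2[of m n] that B C d in \<open>auto simp: ga_norm_nonneg\<close>)
    also have "\<dots> < d * (B + C + 1)" using d by (simp add: algebra_simps)
    also have "\<dots> = e" using B(1) C(1) by (simp add: d_def)
    finally show ?thesis .
  qed
  then show "\<exists>M. \<forall>m\<ge>M. \<forall>n\<ge>M. ga_norm (S m * T m - S n * T n) < e" by blast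
qed

lemma part_equivp_ga_rel: "part_equivp (ga_rel :: (nat \<Rightarrow> ('g::ab_group_add \<Rightarrow>\<^sub>0 complex)) \<Rightarrow> _)"
proof (rule part_equivpI)
  show "\<exists>S. ga_rel S (S :: nat \<Rightarrow> 'g \<Rightarrow>\<^sub>0 complex)"
    by (rule exI[of _ "\<lambda>_. 0"]) (simp add: ga_rel_def ga_cauchy_const ga_norm_zero)
  show "symp (ga_rel :: (nat \<Rightarrow> ('g \<Rightarrow>\<^sub>0 complex)) \<Rightarrow> _)"
    by (rule sympI) (auto simp: ga_rel_def ga_norm_minus_commute)
  show "transp (ga_rel :: (nat \<Rightarrow> ('g \<Rightarrow>\<^sub>0 complex)) \<Rightarrow> _)"
  proof (rule transpI)
    fix S T U :: "nat \<Rightarrow> 'g \<Rightarrow>\<^sub>0 complex"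
    assume "ga_rel S T" "ga_rel T U"
    then have *: "ga_cauchy S" "ga_cauchy U" "(\<lambda>n. ga_norm (S n - T n) + ga_norm (T n - U n)) \<longlonglongrightarrow> 0"
      by (auto simp: ga_rel_def intro: tendsto_add_zero)
    then show "ga_rel S U"
      unfolding ga_rel_def by (intro conjI ga_null_le[OF *(3)] ga_norm_triangle)
  qed
qed

quotient_type (overloaded) 'g group_cstar = "nat \<Rightarrow> ('g::ab_group_add \<Rightarrow>\<^sub>0 complex)" / partial: ga_rel
  by (rule part_equivp_ga_rel)

lemma ga_relI:
  "ga_cauchy S \<Longrightarrow> ga_cauchy T \<Longrightarrow> X \<longlonglongrightarrow> 0 \<Longrightarrow> (\<And>n. ga_norm (S n - T n) \<le> X n) \<Longrightarrow> ga_rel S T"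
  unfolding ga_rel_def by (intro conjI ga_null_le)

lemma ga_rel_self: "ga_rel S S \<longleftrightarrow> ga_cauchy S"
  by (simp add: ga_rel_def ga_norm_zero)

lemmas ga_rel_refl = ga_rel_self[THEN iffD2]

lemma ga_rel_add:
  assumes "ga_rel S S'" "ga_rel T T'"
  shows "ga_rel (\<lambda>n. S n + T n) (\<lambda>n. S' n + T' n)"
proof (rule ga_relI)
  show "(\<lambda>n. ga_norm (S n - S' n) + ga_norm (T n - T' n)) \<longlonglongrightarrow> 0"
    using assms by (auto simp: ga_rel_def intro: tendsto_add_zero)
  show "ga_norm (S n + T n - (S' n + T' n)) \<le> ga_norm (S n - S' n) + ga_norm (T n - T' n)" for n
    using ga_norm_add[of "S n - S' n" "T n - T' n"] by (simp add: algebra_simps)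
qed (use assms in \<open>auto simp: ga_rel_def ga_cauchy_add\<close>)

lemma ga_rel_mult:
  assumes "ga_rel S S'" "ga_rel T T'"
  shows "ga_rel (\<lambda>n. S n * T n) (\<lambda>n. S' n * T' n)"
proof -
  have S: "ga_cauchy S" and T': "ga_cauchy T'" using assms by (simp_all add: ga_rel_def)
  obtain B where B: "B \<ge> 0" "\<And>n. ga_norm (S n) \<le> B"
    using ga_cauchy_bounded[OF S] by blast
  obtain C where C: "C \<ge> 0" "\<And>n. ga_norm (T' n) \<le> C"
    using ga_cauchy_bounded[OF T'] by blast
  show ?thesis
  proof (rule ga_relI)
    show "(\<lambda>n. B * ga_norm (T n - T' n) + ga_norm (S n - S' n) * C) \<longlonglongrightarrow> 0"
      using assms by (auto simp: ga_rel_def intro!: tendsto_add_zero tendsto_mult_right_zero tendsto_mult_left_zero)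
    show "ga_norm (S n * T n - S' n * T' n) \<le> B * ga_norm (T n - T' n) + ga_norm (S n - S' n) * C" for n
      by (rule order_trans[OF ga_mult_diff_le]) (intro add_mono mult_mono; simp add: B C ga_norm_nonneg)
  qed (use assms in \<open>auto simp: ga_rel_def ga_cauchy_mult\<close>)
qed

lemma ga_rel_lipschitz:
  assumes "ga_rel S S'" "K \<ge> 0" "\<And>f h. ga_norm (F f - F h) \<le> K * ga_norm (f - h)"
  shows "ga_rel (\<lambda>n. F (S n)) (\<lambda>n. F (S' n))"
proof (rule ga_relI)
  show "(\<lambda>n. K * ga_norm (S n - S' n)) \<longlonglongrightarrow> 0"
    using assms(1) by (auto simp: ga_rel_def intro: tendsto_mult_right_zero)
qed (use assms in \<open>auto simp: ga_rel_def intro: ga_cauchy_le\<close>)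

lemma ga_scale_diff: "ga_scale c f - ga_scale c h = ga_scale c (f - h)"
  by (simp add: ga_scale_eq algebra_simps)

lemma ga_star_diff: "ga_star f - ga_star h = ga_star (f - h)"
  by (rule poly_mapping_eqI) (simp add: lookup_ga_star lookup_minus)

lemma ga_rel_scale: "ga_rel S S' \<Longrightarrow> ga_rel (\<lambda>n. ga_scale c (S n)) (\<lambda>n. ga_scale c (S' n))"
  by (erule ga_rel_lipschitz[where K = "cmod c"]) (simp_all add: ga_scale_diff ga_norm_scale)

lemma ga_rel_uminus: "ga_rel S S' \<Longrightarrow> ga_rel (\<lambda>n. - S n) (\<lambda>n. - S' n)"
  using ga_rel_scale[of S S' "-1"] by (simp add: ga_scale_eq single_uminus)

lemma ga_rel_diff: "ga_rel S S' \<Longrightarrow> ga_rel T T' \<Longrightarrow> ga_rel (\<lambda>n. S n - T n) (\<lambda>n. S' n - T' n)"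
  using ga_rel_add[OF _ ga_rel_uminus, of S S' T T'] by simp

lemma ga_rel_star: "ga_rel S S' \<Longrightarrow> ga_rel (\<lambda>n. ga_star (S n)) (\<lambda>n. ga_star (S' n))"
  by (erule ga_rel_lipschitz[where K = 1]) (simp_all add: ga_star_diff ga_norm_star)

lemma ga_cauchy_norm:
  assumes "ga_cauchy S" shows "convergent (\<lambda>n. ga_norm (S n))"
proof -
  have "Cauchy (\<lambda>n. ga_norm (S n))"
  proof (rule metric_CauchyI)
    fix e :: real assume "e > 0"
    then obtain M where M: "ga_norm (S m - S n) < e" if "m \<ge> M" "n \<ge> M" for m n
      using assms unfolding ga_cauchy_def by meson
    show "\<exists>M. \<forall>m\<ge>M. \<forall>n\<ge>M. dist (ga_norm (S m)) (ga_norm (S n)) < e"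
      using M ga_norm_diff_abs by (metis dist_real_def order_le_less_trans)
  qed
  then show ?thesis by (simp add: Cauchy_convergent_iff)
qed

lemma ga_rel_norm:
  assumes "ga_rel S S'" shows "lim (\<lambda>n. ga_norm (S n)) = lim (\<lambda>n. ga_norm (S' n))"
proof -
  have "(\<lambda>n. ga_norm (S n) - ga_norm (S' n)) \<longlonglongrightarrow> 0"
    by (rule Lim_null_comparison[where g = "\<lambda>n. ga_norm (S n - S' n)"])
       (use assms in \<open>auto simp: ga_rel_def ga_norm_diff_abs\<close>)
  moreover have "(\<lambda>n. ga_norm (S' n)) \<longlonglongrightarrow> lim (\<lambda>n. ga_norm (S' n))"
    using assms ga_cauchy_norm by (auto simp: ga_rel_def convergent_LIMSEQ_iff)
  ultimately have "(\<lambda>n. ga_norm (S n)) \<longlonglongrightarrow> lim (\<lambda>n. ga_norm (S' n))"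
    using tendsto_add[of "\<lambda>n. ga_norm (S n) - ga_norm (S' n)" 0 sequentially "\<lambda>n. ga_norm (S' n)"] by simp
  then show ?thesis by (rule limI)
qed

lemma ga_norm_LIMSEQ: "ga_cauchy S \<Longrightarrow> (\<lambda>n. ga_norm (S n)) \<longlonglongrightarrow> lim (\<lambda>n. ga_norm (S n))"
  using ga_cauchy_norm by (simp add: convergent_LIMSEQ_iff)

lemma ga_cauchy_scale: "ga_cauchy S \<Longrightarrow> ga_cauchy (\<lambda>n. ga_scale c (S n))"
  using ga_rel_scale[of S S] by (simp add: ga_rel_self)

lemma ga_cauchy_star: "ga_cauchy S \<Longrightarrow> ga_cauchy (\<lambda>n. ga_star (S n))"
  using ga_rel_star[of S S] by (simp add: ga_rel_self)

lifting_forget poly_mapping.lifting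

instantiation group_cstar :: (ab_group_add) comm_ring_1
begin

lift_definition zero_group_cstar :: "'a group_cstar" is "\<lambda>_. 0"
  by (rule ga_rel_refl[OF ga_cauchy_const])
lift_definition one_group_cstar :: "'a group_cstar" is "\<lambda>_. 1"
  by (rule ga_rel_refl[OF ga_cauchy_const])
lift_definition plus_group_cstar :: "'a group_cstar \<Rightarrow> 'a group_cstar \<Rightarrow> 'a group_cstar"
  is "\<lambda>S T n. S n + T n" by (rule ga_rel_add)
lift_definition times_group_cstar :: "'a group_cstar \<Rightarrow> 'a group_cstar \<Rightarrow> 'a group_cstar"
  is "\<lambda>S T n. S n * T n" by (rule ga_rel_mult)
lift_definition uminus_group_cstar :: "'a group_cstar \<Rightarrow> 'a group_cstar"
  is "\<lambda>S n. - S n" by (rule ga_rel_uminus)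
lift_definition minus_group_cstar :: "'a group_cstar \<Rightarrow> 'a group_cstar \<Rightarrow> 'a group_cstar"
  is "\<lambda>S T n. S n - T n" by (rule ga_rel_diff)

instance
proof
  fix a b c :: "'a group_cstar"
  show "a + b + c = a + (b + c)"
    by transfer (simp add: ga_rel_self ga_cauchy_add ga_cauchy_mult add.assoc)
  show "a + b = b + a"
    by transfer (simp add: ga_rel_self ga_cauchy_add ga_cauchy_mult add.commute)
  show "0 + a = a" by transfer simp
  show "- a + a = 0" by transfer (simp add: ga_rel_refl ga_cauchy_const)
  show "a - b = a + - b" by transfer (simp add: ga_rel_diff)
  show "a * b * c = a * (b * c)"
    by transfer (simp add: ga_rel_self ga_cauchy_add ga_cauchy_mult mult.assoc)
  show "a * b = b * a"
    by transfer (simp add: ga_rel_self ga_cauchy_add ga_cauchy_mult mult.commute)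
  show "1 * a = a" by transfer simp
  show "(a + b) * c = a * c + b * c"
    by transfer (simp add: ga_rel_self ga_cauchy_add ga_cauchy_mult distrib_right)
  show "(0 :: 'a group_cstar) \<noteq> 1"
    by transfer (simp add: ga_rel_def ga_norm_minus ga_norm_one LIMSEQ_const_iff)
qed

end

instantiation group_cstar :: (ab_group_add) real_algebra_1
begin

lift_definition scaleR_group_cstar :: "real \<Rightarrow> 'a group_cstar \<Rightarrow> 'a group_cstar"
  is "\<lambda>r S n. ga_scale (complex_of_real r) (S n)" by (rule ga_rel_scale)
instance
proof
  fix a b :: "'a group_cstar" and r s :: real
  note [simp] = ga_rel_self ga_cauchy_add ga_cauchy_mult ga_cauchy_scale ga_scale_simps
  show "r *\<^sub>R (a + b) = r *\<^sub>R a + r *\<^sub>R b"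
    by transfer simp
  show "(r + s) *\<^sub>R a = r *\<^sub>R a + s *\<^sub>R a"
    by transfer simp
  show "r *\<^sub>R s *\<^sub>R a = (r * s) *\<^sub>R a"
    by transfer simp
  show "1 *\<^sub>R a = a" by transfer simp
  show "r *\<^sub>R a * b = r *\<^sub>R (a * b)"
    by transfer simp
  show "a * r *\<^sub>R b = r *\<^sub>R (a * b)"
    by transfer simp
qed

end

instantiation group_cstar :: (ab_group_add) real_normed_algebra_1
begin

lift_definition norm_group_cstar :: "'a group_cstar \<Rightarrow> real"
  is "\<lambda>S. lim (\<lambda>n. ga_norm (S n))" by (rule ga_rel_norm)
definition dist_group_cstar :: "'a group_cstar \<Rightarrow> 'a group_cstar \<Rightarrow> real"
  where "dist_group_cstar a b = norm (a - b)"
definition sgn_group_cstar :: "'a group_cstar \<Rightarrow> 'a group_cstar"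
  where "sgn_group_cstar a = a /\<^sub>R norm a"
definition uniformity_group_cstar :: "('a group_cstar \<times> 'a group_cstar) filter"
  where "uniformity_group_cstar = (INF e\<in>{0<..}. principal {(x, y). dist x y < e})"
definition open_group_cstar :: "'a group_cstar set \<Rightarrow> bool"
  where "open_group_cstar U \<longleftrightarrow> (\<forall>x\<in>U. \<forall>\<^sub>F (x', y) in uniformity. x' = x \<longrightarrow> y \<in> U)"

instance
proof
  fix a b :: "'a group_cstar" and r :: real and U :: "'a group_cstar set"
  note [simp] = ga_rel_self ga_cauchy_add ga_cauchy_mult
  show "dist a b = norm (a - b)" by (rule dist_group_cstar_def)
  show "sgn a = a /\<^sub>R norm a" by (rule sgn_group_cstar_def)
  show "(uniformity :: ('a group_cstar \<times> 'a group_cstar) filter) = (INF e\<in>{0<..}. principal {(x, y). dist x y < e})"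
    by (rule uniformity_group_cstar_def)
  show "open U \<longleftrightarrow> (\<forall>x\<in>U. \<forall>\<^sub>F (x', y) in uniformity. x' = x \<longrightarrow> y \<in> U)"
    by (rule open_group_cstar_def)
  show "norm a = 0 \<longleftrightarrow> a = 0"
  proof transfer
    fix S :: "nat \<Rightarrow> 'a \<Rightarrow>\<^sub>0 complex" assume S: "ga_rel S S"
    show "lim (\<lambda>n. ga_norm (S n)) = 0 \<longleftrightarrow> ga_rel S (\<lambda>_. 0)"
      using S ga_norm_LIMSEQ[of S] by (auto simp: ga_rel_def ga_cauchy_const dest: limI)
  qed
  show "norm (a + b) \<le> norm a + norm b"
  proof transfer
    fix S T :: "nat \<Rightarrow> 'a \<Rightarrow>\<^sub>0 complex" assume "ga_rel S S" "ga_rel T T"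
    then have "ga_cauchy S" "ga_cauchy T" "ga_cauchy (\<lambda>n. S n + T n)" by simp_all
    then show "lim (\<lambda>n. ga_norm (S n + T n)) \<le> lim (\<lambda>n. ga_norm (S n)) + lim (\<lambda>n. ga_norm (T n))"
      by (intro LIMSEQ_le[OF ga_norm_LIMSEQ tendsto_add[OF ga_norm_LIMSEQ ga_norm_LIMSEQ]])
         (auto intro: ga_norm_add)
  qed
  show "norm (r *\<^sub>R a) = \<bar>r\<bar> * norm a"
  proof transfer
    fix S :: "nat \<Rightarrow> 'a \<Rightarrow>\<^sub>0 complex" and r assume "ga_rel S S"
    then have "(\<lambda>n. \<bar>r\<bar> * ga_norm (S n)) \<longlonglongrightarrow> \<bar>r\<bar> * lim (\<lambda>n. ga_norm (S n))"
      by (intro tendsto_mult_left ga_norm_LIMSEQ) simp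
    then show "lim (\<lambda>n. ga_norm (ga_scale (complex_of_real r) (S n))) = \<bar>r\<bar> * lim (\<lambda>n. ga_norm (S n))"
      unfolding ga_norm_scale norm_of_real by (rule limI)
  qed
  show "norm (a * b) \<le> norm a * norm b"
  proof transfer
    fix S T :: "nat \<Rightarrow> 'a \<Rightarrow>\<^sub>0 complex" assume "ga_rel S S" "ga_rel T T"
    then have "ga_cauchy S" "ga_cauchy T" "ga_cauchy (\<lambda>n. S n * T n)" by simp_all
    then show "lim (\<lambda>n. ga_norm (S n * T n)) \<le> lim (\<lambda>n. ga_norm (S n)) * lim (\<lambda>n. ga_norm (T n))"
      by (intro LIMSEQ_le[OF ga_norm_LIMSEQ tendsto_mult[OF ga_norm_LIMSEQ ga_norm_LIMSEQ]])
         (auto intro: ga_norm_mult)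
  qed
  show "norm (1 :: 'a group_cstar) = 1" by transfer (simp add: ga_norm_one)
qed

end

lift_definition of_ga :: "('g::ab_group_add \<Rightarrow>\<^sub>0 complex) \<Rightarrow> 'g group_cstar" is "\<lambda>f _. f"
  by (rule ga_rel_refl[OF ga_cauchy_const])

lemma of_ga_diff: "of_ga (f - h) = of_ga f - of_ga h"
  by transfer (simp add: ga_rel_self ga_cauchy_const)

lemma norm_of_ga: "norm (of_ga f) = ga_norm f"
  by transfer simp

lemma ga_cauchy_diff_const_le:
  assumes "ga_cauchy S" "e > 0"
  shows "\<exists>M. \<forall>k\<ge>M. lim (\<lambda>n. ga_norm (S n - S k)) \<le> e"
proof -
  obtain M where M: "ga_norm (S m - S n) < e" if "m \<ge> M" "n \<ge> M" for m n
    using assms unfolding ga_cauchy_def by meson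
  have "lim (\<lambda>n. ga_norm (S n - S k)) \<le> e" if "k \<ge> M" for k
  proof (rule LIMSEQ_le_const2)
    show "(\<lambda>n. ga_norm (S n - S k)) \<longlonglongrightarrow> lim (\<lambda>n. ga_norm (S n - S k))"
      using ga_cauchy_add[OF assms(1) ga_cauchy_const[of "- S k"]] ga_norm_LIMSEQ by fastforce
    show "\<exists>N. \<forall>n\<ge>N. ga_norm (S n - S k) \<le> e"
      using M that less_imp_le by blast
  qed
  then show ?thesis by blast
qed

lemma of_ga_approx: "\<exists>S. ga_cauchy S \<and> (\<forall>e>0. \<exists>M. \<forall>k\<ge>M. norm (a - of_ga (S k)) \<le> e)"
  by transfer (auto simp: ga_rel_self intro: ga_cauchy_diff_const_le)

lemma of_ga_limit: "ga_cauchy S \<Longrightarrow> \<exists>a. \<forall>e>0. \<exists>M. \<forall>k\<ge>M. norm (a - of_ga (S k)) \<le> e"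
proof transfer
  fix S :: "nat \<Rightarrow> 'a \<Rightarrow>\<^sub>0 complex" assume S: "ga_cauchy S"
  show "\<exists>a\<in>{T. ga_rel T T}. \<forall>e>0. \<exists>M. \<forall>k\<ge>M. lim (\<lambda>n. ga_norm (a n - S k)) \<le> e"
    using S ga_cauchy_diff_const_le[OF S] by (intro bexI[of _ S]) (auto simp: ga_rel_self)
qed

lemma of_ga_dense: "e > 0 \<Longrightarrow> \<exists>f. norm (a - of_ga f) < e"
proof -
  assume "e > 0"
  then have "e / 2 > 0" by simp
  then obtain f where "norm (a - of_ga f) \<le> e / 2" using of_ga_approx[of a] by blast
  then show ?thesis using \<open>e > 0\<close> by (intro exI[of _ f]) simp
qed

instance group_cstar :: (ab_group_add) banach
proof
  fix X :: "nat \<Rightarrow> 'a group_cstar" assume X: "Cauchy X"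
  have "\<exists>f. norm (X k - of_ga f) < inverse (real (Suc k))" for k
    by (rule of_ga_dense) simp
  then obtain S where S: "norm (X k - of_ga (S k)) < inverse (real (Suc k))" for k by metis
  have lim0: "(\<lambda>k. X k - of_ga (S k)) \<longlonglongrightarrow> 0"
    by (rule Lim_null_comparison[OF always_eventually LIMSEQ_inverse_real_of_nat])
       (intro allI less_imp_le[OF S])
  have "ga_cauchy S"
    unfolding ga_cauchy_def
  proof (intro allI impI)
    fix e :: real assume "e > 0"
    then have e: "e / 2 > 0" by simp
    obtain M1 where M1: "norm (X m - X n) < e / 2" if "m \<ge> M1" "n \<ge> M1" for m n
      using CauchyD[OF X e] by blast
    obtain M2 where M2: "norm (X m - of_ga (S m) - (X n - of_ga (S n))) < e / 2" if "m \<ge> M2" "n \<ge> M2" for m n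
      using CauchyD[OF LIMSEQ_imp_Cauchy[OF lim0] e] by blast
    have "ga_norm (S m - S n) < e" if "m \<ge> max M1 M2" "n \<ge> max M1 M2" for m n
    proof -
      have "of_ga (S m - S n) = (X m - X n) - (X m - of_ga (S m) - (X n - of_ga (S n)))"
        by (simp add: of_ga_diff)
      then have "ga_norm (S m - S n) \<le> norm (X m - X n) + norm (X m - of_ga (S m) - (X n - of_ga (S n)))"
        by (metis norm_of_ga norm_triangle_ineq4)
      then show ?thesis using M1[of m n] M2[of m n] that by simp
    qed
    then show "\<exists>M. \<forall>m\<ge>M. \<forall>n\<ge>M. ga_norm (S m - S n) < e" by blast
  qed
  then obtain a where a: "\<And>e. e > 0 \<Longrightarrow> \<exists>M. \<forall>k\<ge>M. norm (a - of_ga (S k)) \<le> e"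
    using of_ga_limit by metis
  have "(\<lambda>k. of_ga (S k)) \<longlonglongrightarrow> a"
  proof (rule LIMSEQ_I)
    fix e :: real assume "e > 0"
    then obtain M where "\<forall>k\<ge>M. norm (a - of_ga (S k)) \<le> e / 2" using a[of "e / 2"] by auto
    then show "\<exists>M. \<forall>k\<ge>M. norm (of_ga (S k) - a) < e"
      using \<open>e > 0\<close> by (intro exI[of _ M]) (auto simp: norm_minus_commute intro: le_less_trans)
  qed
  from tendsto_add[OF this lim0] have "X \<longlonglongrightarrow> a" by simp
  then show "convergent X" by (rule convergentI)
qed

instantiation group_cstar :: (ab_group_add) cstar_algebra
begin

lift_definition scaleC_group_cstar :: "complex \<Rightarrow> 'a group_cstar \<Rightarrow> 'a group_cstar"
  is "\<lambda>c S n. ga_scale c (S n)" by (rule ga_rel_scale)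
lift_definition star_group_cstar :: "'a group_cstar \<Rightarrow> 'a group_cstar"
  is "\<lambda>S n. ga_star (S n)" by (rule ga_rel_star)

instance
proof
  fix a b :: "'a group_cstar" and c d :: complex and r :: real
  note [simp] = ga_rel_self ga_cauchy_add ga_cauchy_mult ga_cauchy_scale ga_cauchy_star
    ga_scale_simps
  show "complex_of_real r *\<^sub>C a = r *\<^sub>R a"
    by transfer (simp add: ga_cauchy_scale)
  show "(c + d) *\<^sub>C a = c *\<^sub>C a + d *\<^sub>C a"
    by transfer simp
  show "c *\<^sub>C (a + b) = c *\<^sub>C a + c *\<^sub>C b"
    by transfer simp
  show "c *\<^sub>C d *\<^sub>C a = (c * d) *\<^sub>C a"
    by transfer simp
  show "c *\<^sub>C a * b = c *\<^sub>C (a * b)"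
    by transfer simp
  show "a * c *\<^sub>C b = c *\<^sub>C (a * b)"
    by transfer simp
  show "norm (c *\<^sub>C a) = cmod c * norm a"
  proof transfer
    fix S :: "nat \<Rightarrow> 'a \<Rightarrow>\<^sub>0 complex" and c assume "ga_rel S S"
    then have "(\<lambda>n. cmod c * ga_norm (S n)) \<longlonglongrightarrow> cmod c * lim (\<lambda>n. ga_norm (S n))"
      by (intro tendsto_mult_left ga_norm_LIMSEQ) simp
    then show "lim (\<lambda>n. ga_norm (ga_scale c (S n))) = cmod c * lim (\<lambda>n. ga_norm (S n))"
      unfolding ga_norm_scale by (rule limI)
  qed
  show "star (star a) = a" by transfer (simp add: ga_star_star)
  show "star (a + b) = star a + star b" by transfer (simp add: ga_star_add)
  show "star (c *\<^sub>C a) = cnj c *\<^sub>C star a"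
    by transfer (simp add: ga_star_scale)
  show "star (a * b) = star b * star a" by transfer (simp add: ga_star_mult)
  show "norm (star a * a) = (norm a)\<^sup>2"
  proof transfer
    fix S :: "nat \<Rightarrow> 'a \<Rightarrow>\<^sub>0 complex" assume "ga_rel S S"
    then have "(\<lambda>n. (ga_norm (S n))\<^sup>2) \<longlonglongrightarrow> (lim (\<lambda>n. ga_norm (S n)))\<^sup>2"
      by (intro tendsto_power ga_norm_LIMSEQ) simp
    then show "lim (\<lambda>n. ga_norm (ga_star (S n) * S n)) = (lim (\<lambda>n. ga_norm (S n)))\<^sup>2"
      unfolding ga_norm_star_mult by (rule limI)
  qed
qed

end

definition group_unitary :: "'g::ab_group_add \<Rightarrow> 'g group_cstar"
  where "group_unitary g = of_ga (Poly_Mapping.single g 1)"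

definition induced_hom :: "('g::ab_group_add \<Rightarrow> 'h::ab_group_add) \<Rightarrow> 'g group_cstar \<Rightarrow> 'h group_cstar"
  where "induced_hom f = (THE \<phi>. star_hom \<phi> \<and> (\<forall>g. \<phi> (group_unitary g) = group_unitary (f g)))"

text \<open>Restriction of functions to a subgroup \<open>H\<close>, extended by continuity; its range is the closed
  span of the unitaries of \<open>H\<close>, the copy of the C*-algebra of \<open>H\<close> inside that of the group.\<close>

definition cond_expectation :: "'g::ab_group_add set \<Rightarrow> 'g group_cstar \<Rightarrow> 'g group_cstar"
  where "cond_expectation H = (THE E. bounded_clinear E \<and>
    (\<forall>g. E (group_unitary g) = (if g \<in> H then group_unitary g else 0)))"


section \<open>Right Hilbert bimodules\<close>

record ('x, 'a) bimodule =
  hcarrier :: "'x set"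
  hadd :: "'x \<Rightarrow> 'x \<Rightarrow> 'x"
  hzero :: 'x
  hscale :: "complex \<Rightarrow> 'x \<Rightarrow> 'x"
  lact :: "'a \<Rightarrow> 'x \<Rightarrow> 'x"
  ract :: "'x \<Rightarrow> 'a \<Rightarrow> 'x"
  hinner :: "'x \<Rightarrow> 'x \<Rightarrow> 'a"

definition hdist :: "('x, 'a::cstar_algebra) bimodule \<Rightarrow> 'x \<Rightarrow> 'x \<Rightarrow> real"
  where "hdist X x y = (let d = hadd X x (hscale X (-1) y) in sqrt (norm (hinner X d d)))"

locale hilbert_bimodule =
  fixes X :: "('x, 'a::cstar_algebra) bimodule"
  assumes add_closed: "x \<in> hcarrier X \<Longrightarrow> y \<in> hcarrier X \<Longrightarrow> hadd X x y \<in> hcarrier X"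
    and zero_closed: "hzero X \<in> hcarrier X"
    and scale_closed: "x \<in> hcarrier X \<Longrightarrow> hscale X c x \<in> hcarrier X"
    and lact_closed: "x \<in> hcarrier X \<Longrightarrow> lact X a x \<in> hcarrier X"
    and ract_closed: "x \<in> hcarrier X \<Longrightarrow> ract X x a \<in> hcarrier X"
    and add_assoc: "x \<in> hcarrier X \<Longrightarrow> y \<in> hcarrier X \<Longrightarrow> z \<in> hcarrier X \<Longrightarrow>
      hadd X (hadd X x y) z = hadd X x (hadd X y z)"
    and add_commute: "x \<in> hcarrier X \<Longrightarrow> y \<in> hcarrier X \<Longrightarrow> hadd X x y = hadd X y x"
    and add_zero: "x \<in> hcarrier X \<Longrightarrow> hadd X x (hzero X) = x"
    and add_neg: "x \<in> hcarrier X \<Longrightarrow> hadd X x (hscale X (-1) x) = hzero X"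
    and scale_add_right: "x \<in> hcarrier X \<Longrightarrow> y \<in> hcarrier X \<Longrightarrow>
      hscale X c (hadd X x y) = hadd X (hscale X c x) (hscale X c y)"
    and scale_add_left: "x \<in> hcarrier X \<Longrightarrow> hscale X (c + d) x = hadd X (hscale X c x) (hscale X d x)"
    and scale_scale: "x \<in> hcarrier X \<Longrightarrow> hscale X c (hscale X d x) = hscale X (c * d) x"
    and scale_one: "x \<in> hcarrier X \<Longrightarrow> hscale X 1 x = x"
    and ract_add: "x \<in> hcarrier X \<Longrightarrow> y \<in> hcarrier X \<Longrightarrow>
      ract X (hadd X x y) a = hadd X (ract X x a) (ract X y a)"
    and ract_plus: "x \<in> hcarrier X \<Longrightarrow> ract X x (a + b) = hadd X (ract X x a) (ract X x b)"
    and ract_mult: "x \<in> hcarrier X \<Longrightarrow> ract X x (a * b) = ract X (ract X x a) b"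
    and ract_one: "x \<in> hcarrier X \<Longrightarrow> ract X x 1 = x"
    and ract_scale: "x \<in> hcarrier X \<Longrightarrow> ract X (hscale X c x) a = hscale X c (ract X x a)"
    and ract_scaleC: "x \<in> hcarrier X \<Longrightarrow> ract X x (c *\<^sub>C a) = hscale X c (ract X x a)"
    and inner_add: "x \<in> hcarrier X \<Longrightarrow> y \<in> hcarrier X \<Longrightarrow> z \<in> hcarrier X \<Longrightarrow>
      hinner X x (hadd X y z) = hinner X x y + hinner X x z"
    and inner_scale: "x \<in> hcarrier X \<Longrightarrow> y \<in> hcarrier X \<Longrightarrow> hinner X x (hscale X c y) = c *\<^sub>C hinner X x y"
    and inner_ract: "x \<in> hcarrier X \<Longrightarrow> y \<in> hcarrier X \<Longrightarrow> hinner X x (ract X y a) = hinner X x y * a"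
    and inner_star: "x \<in> hcarrier X \<Longrightarrow> y \<in> hcarrier X \<Longrightarrow> star (hinner X x y) = hinner X y x"
    and inner_nonneg: "x \<in> hcarrier X \<Longrightarrow> cstar_nonneg (hinner X x x)"
    and inner_definite: "x \<in> hcarrier X \<Longrightarrow> hinner X x x = 0 \<Longrightarrow> x = hzero X"
    and complete: "(\<And>n. s n \<in> hcarrier X) \<Longrightarrow>
      (\<And>e. e > 0 \<Longrightarrow> \<exists>M. \<forall>m\<ge>M. \<forall>n\<ge>M. hdist X (s m) (s n) < e) \<Longrightarrow>
      \<exists>x\<in>hcarrier X. (\<lambda>n. hdist X (s n) x) \<longlonglongrightarrow> 0"
    and lact_add: "x \<in> hcarrier X \<Longrightarrow> y \<in> hcarrier X \<Longrightarrow>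
      lact X a (hadd X x y) = hadd X (lact X a x) (lact X a y)"
    and lact_plus: "x \<in> hcarrier X \<Longrightarrow> lact X (a + b) x = hadd X (lact X a x) (lact X b x)"
    and lact_mult: "x \<in> hcarrier X \<Longrightarrow> lact X (a * b) x = lact X a (lact X b x)"
    and lact_scale: "x \<in> hcarrier X \<Longrightarrow> lact X a (hscale X c x) = hscale X c (lact X a x)"
    and lact_scaleC: "x \<in> hcarrier X \<Longrightarrow> lact X (c *\<^sub>C a) x = hscale X c (lact X a x)"
    and lact_ract: "x \<in> hcarrier X \<Longrightarrow> lact X a (ract X x b) = ract X (lact X a x) b"
    and inner_lact: "x \<in> hcarrier X \<Longrightarrow> y \<in> hcarrier X \<Longrightarrow>
      hinner X (lact X a x) y = hinner X x (lact X (star a) y)"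

definition bimodule_iso ::
    "('x, 'a::cstar_algebra) bimodule \<Rightarrow> ('y, 'a) bimodule \<Rightarrow> ('x \<Rightarrow> 'y) \<Rightarrow> bool"
  where "bimodule_iso X Y U \<longleftrightarrow> bij_betw U (hcarrier X) (hcarrier Y) \<and> U (hzero X) = hzero Y \<and>
    (\<forall>x\<in>hcarrier X. \<forall>y\<in>hcarrier X. U (hadd X x y) = hadd Y (U x) (U y)) \<and>
    (\<forall>x\<in>hcarrier X. \<forall>c. U (hscale X c x) = hscale Y c (U x)) \<and>
    (\<forall>x\<in>hcarrier X. \<forall>a. U (lact X a x) = lact Y a (U x)) \<and>
    (\<forall>x\<in>hcarrier X. \<forall>a. U (ract X x a) = ract Y (U x) a) \<and>
    (\<forall>x\<in>hcarrier X. \<forall>y\<in>hcarrier X. hinner Y (U x) (U y) = hinner X x y)"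

definition standard_bimodule :: "('a::cstar_algebra, 'a) bimodule"
  where "standard_bimodule = \<lparr>hcarrier = UNIV, hadd = (+), hzero = 0, hscale = scaleC,
    lact = (*), ract = (*), hinner = (\<lambda>a b. star a * b)\<rparr>"


section \<open>The interior tensor product\<close>

text \<open>A list \<open>[(x\<^sub>1, y\<^sub>1), \<dots>, (x\<^sub>n, y\<^sub>n)]\<close> stands for the sum of the elementary tensors of its
  entries. The interior tensor product over the coefficient algebra is the Hausdorff completion of
  these sums in the seminorm given by \<open>\<langle>x \<otimes> y, x' \<otimes> y'\<rangle> = \<langle>y, \<langle>x, x'\<rangle> y'\<rangle>\<close>. The relations of the
  balanced tensor product need not be imposed separately, since they have seminorm zero.\<close>

definition tsums :: "('x, 'a) bimodule \<Rightarrow> ('y, 'a) bimodule \<Rightarrow> ('x \<times> 'y) list set"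
  where "tsums X Y = lists (hcarrier X \<times> hcarrier Y)"

definition tinner ::
    "('x, 'a::cstar_algebra) bimodule \<Rightarrow> ('y, 'a) bimodule \<Rightarrow> ('x \<times> 'y) list \<Rightarrow> ('x \<times> 'y) list \<Rightarrow> 'a"
  where "tinner X Y s t =
    (\<Sum>(x, y)\<leftarrow>s. \<Sum>(x', y')\<leftarrow>t. hinner Y y (lact Y (hinner X x x') y'))"

definition tscale :: "('x, 'a) bimodule \<Rightarrow> complex \<Rightarrow> ('x \<times> 'y) list \<Rightarrow> ('x \<times> 'y) list"
  where "tscale X c s = map (\<lambda>(x, y). (hscale X c x, y)) s"

definition tdist ::
    "('x, 'a::cstar_algebra) bimodule \<Rightarrow> ('y, 'a) bimodule \<Rightarrow> ('x \<times> 'y) list \<Rightarrow> ('x \<times> 'y) list \<Rightarrow> real"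
  where "tdist X Y s t = (let d = s @ tscale X (-1) t in sqrt (norm (tinner X Y d d)))"

definition tcauchy ::
    "('x, 'a::cstar_algebra) bimodule \<Rightarrow> ('y, 'a) bimodule \<Rightarrow> (nat \<Rightarrow> ('x \<times> 'y) list) set"
  where "tcauchy X Y = {S. (\<forall>n. S n \<in> tsums X Y) \<and>
    (\<forall>e>0. \<exists>M. \<forall>m\<ge>M. \<forall>n\<ge>M. tdist X Y (S m) (S n) < e)}"

definition trel ::
    "('x, 'a::cstar_algebra) bimodule \<Rightarrow> ('y, 'a) bimodule \<Rightarrow> (nat \<Rightarrow> ('x \<times> 'y) list) rel"
  where "trel X Y = {(S, T). S \<in> tcauchy X Y \<and> T \<in> tcauchy X Y \<and>
    (\<lambda>n. tdist X Y (S n) (T n)) \<longlonglongrightarrow> 0}"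

type_synonym ('x, 'y) tensor = "(nat \<Rightarrow> ('x \<times> 'y) list) set"

definition tclass ::
    "('x, 'a::cstar_algebra) bimodule \<Rightarrow> ('y, 'a) bimodule \<Rightarrow> (nat \<Rightarrow> ('x \<times> 'y) list) \<Rightarrow> ('x, 'y) tensor"
  where "tclass X Y S = trel X Y `` {S}"

definition trep :: "('x, 'y) tensor \<Rightarrow> nat \<Rightarrow> ('x \<times> 'y) list"
  where "trep C = (SOME S. S \<in> C)"

definition tensor_bimodule ::
    "('x, 'a::cstar_algebra) bimodule \<Rightarrow> ('y, 'a) bimodule \<Rightarrow> (('x, 'y) tensor, 'a) bimodule"
  where "tensor_bimodule X Y = \<lparr>
    hcarrier = tcauchy X Y // trel X Y,
    hadd = (\<lambda>C D. tclass X Y (\<lambda>n. trep C n @ trep D n)),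
    hzero = tclass X Y (\<lambda>_. []),
    hscale = (\<lambda>c C. tclass X Y (\<lambda>n. tscale X c (trep C n))),
    lact = (\<lambda>a C. tclass X Y (\<lambda>n. map (\<lambda>(x, y). (lact X a x, y)) (trep C n))),
    ract = (\<lambda>C a. tclass X Y (\<lambda>n. map (\<lambda>(x, y). (x, ract Y y a)) (trep C n))),
    hinner = (\<lambda>C D. lim (\<lambda>n. tinner X Y (trep C n) (trep D n)))\<rparr>"

definition elem_tensor ::
    "('x, 'a::cstar_algebra) bimodule \<Rightarrow> ('y, 'a) bimodule \<Rightarrow> 'x \<Rightarrow> 'y \<Rightarrow> ('x, 'y) tensor"
  where "elem_tensor X Y x y = tclass X Y (\<lambda>_. [(x, y)])"


section \<open>Product systems\<close>

text \<open>The fibres are pairwise disjoint subsets of one type; \<open>unit_emb\<close> is the identification of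
  the coefficient algebra with the fibre over the identity.\<close>

record ('p, 'x, 'a) psystem =
  fiber :: "'p \<Rightarrow> ('x, 'a) bimodule"
  unit_emb :: "'a \<Rightarrow> 'x"
  pmult :: "'x \<Rightarrow> 'x \<Rightarrow> 'x"

locale product_system =
  fixes X :: "('p::monoid_mult, 'x, 'a::cstar_algebra) psystem"
  assumes disjoint: "p \<noteq> q \<Longrightarrow> hcarrier (fiber X p) \<inter> hcarrier (fiber X q) = {}"
    and fiber_bimodule: "p \<noteq> 1 \<Longrightarrow> hilbert_bimodule (fiber X p)"
    and unit_fiber: "bimodule_iso standard_bimodule (fiber X 1) (unit_emb X)"
    and mult_closed: "x \<in> hcarrier (fiber X p) \<Longrightarrow> y \<in> hcarrier (fiber X q) \<Longrightarrow>
      pmult X x y \<in> hcarrier (fiber X (p * q))"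
    and mult_assoc: "x \<in> hcarrier (fiber X p) \<Longrightarrow> y \<in> hcarrier (fiber X q) \<Longrightarrow>
      z \<in> hcarrier (fiber X r) \<Longrightarrow> pmult X (pmult X x y) z = pmult X x (pmult X y z)"
    and mult_tensor: "p \<noteq> 1 \<Longrightarrow> q \<noteq> 1 \<Longrightarrow>
      \<exists>U. bimodule_iso (tensor_bimodule (fiber X p) (fiber X q)) (fiber X (p * q)) U \<and>
        (\<forall>x\<in>hcarrier (fiber X p). \<forall>y\<in>hcarrier (fiber X q).
          U (elem_tensor (fiber X p) (fiber X q) x y) = pmult X x y)"
    and mult_unit_left: "x \<in> hcarrier (fiber X p) \<Longrightarrow> pmult X (unit_emb X a) x = lact (fiber X p) a x"
    and mult_unit_right: "x \<in> hcarrier (fiber X p) \<Longrightarrow> pmult X x (unit_emb X a) = ract (fiber X p) x a"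


section \<open>The product system of an action and its twist\<close>

definition injective_action :: "('p::monoid_mult \<Rightarrow> 'g::ab_group_add \<Rightarrow> 'g) \<Rightarrow> bool"
  where "injective_action \<theta> \<longleftrightarrow>
    (\<forall>p g h. \<theta> p (g + h) = \<theta> p g + \<theta> p h) \<and> (\<forall>p. inj (\<theta> p)) \<and>
    (\<forall>p q. \<theta> (p * q) = \<theta> p \<circ> \<theta> q) \<and> \<theta> 1 = id"

text \<open>The pair \<open>(p, a)\<close> stands for \<open>a\<close> times the generator of the fibre over \<open>p\<close>.\<close>

definition action_fiber ::
    "('p \<Rightarrow> 'g::ab_group_add \<Rightarrow> 'g) \<Rightarrow> 'p \<Rightarrow> ('p \<times> 'g group_cstar, 'g group_cstar) bimodule"
  where "action_fiber \<theta> p = \<lparr>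
    hcarrier = {p} \<times> UNIV,
    hadd = (\<lambda>x y. (p, snd x + snd y)),
    hzero = (p, 0),
    hscale = (\<lambda>c x. (p, c *\<^sub>C snd x)),
    lact = (\<lambda>a x. (p, a * snd x)),
    ract = (\<lambda>x a. (p, snd x * induced_hom (\<theta> p) a)),
    hinner = (\<lambda>x y. inv (induced_hom (\<theta> p)) (cond_expectation (range (\<theta> p)) (star (snd x) * snd y)))\<rparr>"

definition action_system ::
    "('p::monoid_mult \<Rightarrow> 'g::ab_group_add \<Rightarrow> 'g) \<Rightarrow> ('p, 'p \<times> 'g group_cstar, 'g group_cstar) psystem"
  where "action_system \<theta> = \<lparr>
    fiber = action_fiber \<theta>,
    unit_emb = (\<lambda>a. (1, a)),
    pmult = (\<lambda>(p, a) (q, b). (p * q, a * induced_hom (\<theta> p) b))\<rparr>"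

definition normalized_cocycle ::
    "('p::monoid_mult \<Rightarrow> 'g::ab_group_add \<Rightarrow> 'g) \<Rightarrow> ('p \<Rightarrow> 'p \<Rightarrow> 'g group_cstar) \<Rightarrow> bool"
  where "normalized_cocycle \<theta> \<xi> \<longleftrightarrow>
    (\<forall>p q. p = 1 \<or> q = 1 \<longrightarrow> \<xi> p q = 0) \<and>
    (\<forall>p q r. induced_hom (\<theta> p) (\<xi> q r) - \<xi> (p * q) r + \<xi> p (q * r) - \<xi> p q = 0)"

definition twisted_system ::
    "('p::monoid_mult \<Rightarrow> 'g::ab_group_add \<Rightarrow> 'g) \<Rightarrow> ('p \<Rightarrow> 'p \<Rightarrow> 'g group_cstar) \<Rightarrow>
     ('p, 'p \<times> 'g group_cstar, 'g group_cstar) psystem"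
  where "twisted_system \<theta> \<xi> = \<lparr>
    fiber = action_fiber \<theta>,
    unit_emb = (\<lambda>a. (1, a)),
    pmult = (\<lambda>(p, a) (q, b). (p * q, exp (\<i> *\<^sub>C \<xi> p q) * a * induced_hom (\<theta> p) b))\<rparr>"

end

theory Submission
  imports Defs
begin

text \<open>The fibres of the twisted system are those of the original one, so only the multiplication
  has to be examined. Put \<open>u p q = exp (\<i> \<xi> p q)\<close>. Since \<open>\<xi>\<close> is self-adjoint, \<open>u p q\<close> is unitary;
  since \<open>\<theta>\<close> induces continuous homomorphisms and \<open>C*(G)\<close> is commutative, exponentiating the cocycle
  identity gives \<open>\<theta>\<^sub>p (u q r) u p (q r) = u (p q) r u p q\<close>, which is associativity. Left multiplication
  by a unitary of the commutative coefficient algebra is an automorphism of the fibre over \<open>p q\<close>, and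
  composing it with the isomorphism given for the untwisted system yields the one required of the
  twisted system.\<close>

section \<open>Homomorphisms and the exponential series\<close>

text \<open>Continuity and multiplicativity carry the exponential series over term by term. Since
  \<open>star_hom\<close> does not include unitality, \<open>f 1 = 1\<close> is assumed for the
  zeroth term.\<close>

lemma star_hom_exp:
  assumes "star_hom f" "f 1 = 1"
  shows "f (exp a) = exp (f a)"
proof -
  have lin: "bounded_linear f" and mult: "\<And>x y. f (x * y) = f x * f y"
    using assms(1) by (auto simp: star_hom_def bounded_clinear_def)
  have pow: "f (a ^ n) = f a ^ n" for n
    by (induction n) (simp_all add: assms(2) mult)
  have "(\<lambda>n. f (a ^ n /\<^sub>R fact n)) sums f (exp a)"
    by (rule bounded_linear.sums[OF lin exp_converges])
  then have "(\<lambda>n. f a ^ n /\<^sub>R fact n) sums f (exp a)"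
    by (simp add: linear_cmul[OF bounded_linear.linear[OF lin]] pow)
  then show ?thesis
    using exp_converges sums_unique2 by blast
qed

text \<open>The C*-identity and submultiplicativity bound the square of \<open>norm b\<close> by
  \<open>norm (star b) * norm b\<close>; cancel, then apply the result to \<open>star a\<close> as
  well.\<close>

lemma norm_star: "norm (star a) = norm (a :: 'a::cstar_algebra)"
proof -
  have le: "norm b \<le> norm (star b)" for b :: 'a
  proof (cases "b = 0")
    case False
    then show ?thesis
      using norm_star_mult[of b] norm_mult_ineq[of "star b" b] by (simp add: power2_eq_square)
  qed simp
  show ?thesis using le[of a] le[of "star a"] by (simp add: star_star)
qed

lemma bounded_linear_star: "bounded_linear (star :: 'a::cstar_algebra \<Rightarrow> 'a)"
proof (rule bounded_linear_intro)
  show "star (r *\<^sub>R x) = r *\<^sub>R star x" for r and x :: 'a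
    by (metis complex_cnj_complex_of_real scaleC_of_real star_scaleC)
  show "norm (star x) \<le> norm x * 1" for x :: 'a
    by (simp add: norm_star)
qed (rule star_add)

lemma star_one: "star (1 :: 'a::cstar_algebra) = 1"
  by (metis mult_1_left mult_1_right star_mult star_star)

text \<open>The series has real coefficients, so conjugate-linearity is harmless, and reversing the
  factors of a power changes nothing.\<close>

lemma star_exp: "star (exp a) = exp (star (a :: 'a::cstar_algebra))"
proof -
  have pow: "star (a ^ n) = star a ^ n" for n
    by (induction n) (simp_all add: star_one star_mult power_commutes)
  have "(\<lambda>n. star (a ^ n /\<^sub>R fact n)) sums star (exp a)"
    by (rule bounded_linear.sums[OF bounded_linear_star exp_converges])
  then have "(\<lambda>n. star a ^ n /\<^sub>R fact n) sums star (exp a)"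
    by (simp add: linear_cmul[OF bounded_linear.linear[OF bounded_linear_star]] pow)
  then show ?thesis
    using exp_converges sums_unique2 by blast
qed

lemma scaleC_minus_left: "(- c) *\<^sub>C x = - (c *\<^sub>C (x :: 'a::cstar_algebra))"
proof -
  have "(- c) *\<^sub>C x + c *\<^sub>C x = complex_of_real 0 *\<^sub>C x"
    by (simp flip: scaleC_add_left)
  then show ?thesis
    by (simp add: scaleC_of_real eq_neg_iff_add_eq_0 del: of_real_0)
qed

text \<open>This is what makes the twisting factors unitary: the right-hand side is the inverse of
  \<open>exp (\<i> *\<^sub>C a)\<close>.\<close>

lemma star_exp_ii:
  assumes "self_adjoint a"
  shows "star (exp (\<i> *\<^sub>C a)) = exp (- (\<i> *\<^sub>C a))"
  using assms by (simp add: star_exp star_scaleC self_adjoint_def scaleC_minus_left)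


section \<open>The homomorphism of group C*-algebras induced by a group homomorphism\<close>

text \<open>Push-forward along \<open>\<theta>\<close>; coefficients of group elements with the same
  image are added.\<close>

definition ga_map :: "('g \<Rightarrow> 'h) \<Rightarrow> ('g::ab_group_add \<Rightarrow>\<^sub>0 complex) \<Rightarrow> ('h::ab_group_add \<Rightarrow>\<^sub>0 complex)"
  where "ga_map \<theta> f = (\<Sum>g\<in>Poly_Mapping.keys f. Poly_Mapping.single (\<theta> g) (Poly_Mapping.lookup f g))"

text \<open>Allows two functions with different supports to be summed over one common index set; the
  extra terms vanish.\<close>

lemma ga_map_eq:
  assumes "finite S" "Poly_Mapping.keys f \<subseteq> S"
  shows "ga_map \<theta> f = (\<Sum>g\<in>S. Poly_Mapping.single (\<theta> g) (Poly_Mapping.lookup f g))"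
  unfolding ga_map_def by (rule sum.mono_neutral_left) (use assms in \<open>auto simp: in_keys_iff\<close>)

lemma ga_map_zero: "ga_map \<theta> 0 = 0"
  by (simp add: ga_map_def)

lemma ga_map_single: "ga_map \<theta> (Poly_Mapping.single g c) = Poly_Mapping.single (\<theta> g) c"
  by (simp add: ga_map_def)

lemma ga_map_add: "ga_map \<theta> (f + h) = ga_map \<theta> f + ga_map \<theta> h"
proof -
  let ?S = "Poly_Mapping.keys f \<union> Poly_Mapping.keys h"
  have "ga_map \<theta> (f + h) = (\<Sum>g\<in>?S. Poly_Mapping.single (\<theta> g) (Poly_Mapping.lookup (f + h) g))"
    by (rule ga_map_eq) (simp_all add: Poly_Mapping.keys_add)
  also have "\<dots> = ga_map \<theta> f + ga_map \<theta> h"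
    by (simp add: lookup_add single_add sum.distrib ga_map_eq[of ?S f] ga_map_eq[of ?S h])
  finally show ?thesis .
qed

context
  fixes \<theta> :: "'g::ab_group_add \<Rightarrow> 'h::ab_group_add"
  assumes \<theta>: "Modules.additive \<theta>"
begin

text \<open>Both sides are biadditive, so induction in each factor reduces the claim to point
  masses, where it is additivity of \<open>\<theta>\<close>.\<close>

lemma ga_map_mult: "ga_map \<theta> (f * h) = ga_map \<theta> f * ga_map \<theta> h"
proof (induction f rule: ga_induct)
  case (single g c)
  show ?case
    by (induction h rule: ga_induct)
       (simp_all add: ga_map_zero ga_map_single ga_map_add mult_single algebra_simps Modules.additive.add[OF \<theta>])
qed (simp_all add: ga_map_zero ga_map_add algebra_simps)

lemma ga_map_scale: "ga_map \<theta> (ga_scale c f) = ga_scale c (ga_map \<theta> f)"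
  by (simp add: ga_scale_eq ga_map_mult ga_map_single Modules.additive.zero[OF \<theta>])

lemma ga_map_star: "ga_map \<theta> (ga_star f) = ga_star (ga_map \<theta> f)"
  by (induction f rule: ga_induct)
     (simp_all add: ga_map_zero ga_star_zero ga_star_single ga_map_single ga_map_add ga_star_add
       Modules.additive.minus[OF \<theta>])

lemma ga_map_diff: "ga_map \<theta> f - ga_map \<theta> h = ga_map \<theta> (f - h)"
  using ga_map_add[of \<theta> "f - h" h] by simp

text \<open>Contractivity is maximality of the norm: the pullback of \<open>ga_norm\<close> along \<open>\<theta>\<close> is a C*-seminorm.\<close>

lemma ga_norm_map_le: "ga_norm (ga_map \<theta> f) \<le> ga_norm f"
proof -
  have "cstar_seminorm (\<lambda>f. ga_norm (ga_map \<theta> f))"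
    unfolding cstar_seminorm_def
    by (simp add: ga_map_add ga_map_scale ga_map_mult ga_map_star ga_norm_add ga_norm_scale
        ga_norm_mult ga_norm_star_mult)
  then show ?thesis by (rule ga_norm_upper)
qed

lemma ga_cauchy_map: "ga_cauchy S \<Longrightarrow> ga_cauchy (\<lambda>n. ga_map \<theta> (S n))"
  by (erule ga_cauchy_le[where K = 1]) (simp_all add: ga_map_diff ga_norm_map_le)

end

text \<open>The lifting must respect \<open>ga_rel\<close> for every \<open>\<theta>\<close>, while
  contractivity is available only for additive ones; hence the guard with default value 0.\<close>

lift_definition group_cstar_map :: "('g::ab_group_add \<Rightarrow> 'h::ab_group_add) \<Rightarrow> 'g group_cstar \<Rightarrow> 'h group_cstar"
  is "\<lambda>\<theta> S n. if Modules.additive \<theta> then ga_map \<theta> (S n) else 0"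
proof -
  fix \<theta> :: "'g \<Rightarrow> 'h" and S T :: "nat \<Rightarrow> 'g \<Rightarrow>\<^sub>0 complex"
  assume "ga_rel S T"
  then have "ga_rel (\<lambda>n. ga_map \<theta> (S n)) (\<lambda>n. ga_map \<theta> (T n))" if "Modules.additive \<theta>"
    by (rule ga_rel_lipschitz[where K = 1]) (simp_all add: ga_map_diff ga_norm_map_le that)
  then show "ga_rel (\<lambda>n. if Modules.additive \<theta> then ga_map \<theta> (S n) else 0)
      (\<lambda>n. if Modules.additive \<theta> then ga_map \<theta> (T n) else 0)"
    by (cases "Modules.additive \<theta>") (simp_all add: ga_rel_self ga_cauchy_const)
qed

lemma of_ga_add: "of_ga (f + h) = of_ga f + of_ga h"
  by transfer (simp add: ga_rel_self ga_cauchy_const)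

lemma of_ga_scale: "of_ga (ga_scale c f) = c *\<^sub>C of_ga f"
  by transfer (simp add: ga_rel_self ga_cauchy_const)

lemma of_ga_zero: "of_ga 0 = 0"
  by transfer (simp add: ga_rel_self ga_cauchy_const)

lemma of_ga_single: "of_ga (Poly_Mapping.single g c) = c *\<^sub>C group_unitary g"
proof -
  have "Poly_Mapping.single g c = ga_scale c (Poly_Mapping.single g 1)"
    by (simp add: ga_scale_eq mult_single)
  then show ?thesis by (simp add: group_unitary_def of_ga_scale)
qed

lemma group_unitary_zero: "group_unitary 0 = 1"
  unfolding group_unitary_def by transfer (simp add: ga_rel_self ga_cauchy_const)

text \<open>The unitaries span the dense image of the group algebra, and the difference of the two
  maps is continuous and vanishes there.\<close>

lemma bounded_clinear_group_cstar_eqI: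
  fixes f h :: "'g::ab_group_add group_cstar \<Rightarrow> 'b::cstar_algebra"
  assumes "bounded_clinear f" "bounded_clinear h" "\<And>g. f (group_unitary g) = h (group_unitary g)"
  shows "f = h"
proof
  fix a :: "'g group_cstar"
  define d where "d x = f x - h x" for x
  have lin: "bounded_linear d"
    unfolding d_def using assms(1,2) by (intro bounded_linear_sub) (auto simp: bounded_clinear_def)
  have "f (of_ga k) = h (of_ga k)" for k
  proof (induction k rule: ga_induct)
    case zero
    then show ?case
      using assms(1,2) by (simp add: of_ga_zero bounded_clinear_def linear_0 bounded_linear.linear)
  next
    case (single g c)
    then show ?case using assms by (simp add: of_ga_single bounded_clinear_def)
  next
    case (add k l)
    then show ?case
      using assms(1,2) by (simp add: of_ga_add bounded_clinear_def linear_add bounded_linear.linear)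
  qed
  then have d_of_ga: "d (of_ga k) = 0" for k
    by (simp add: d_def)
  obtain X where X: "(\<lambda>n. of_ga (X n)) \<longlonglongrightarrow> a"
  proof -
    have "\<exists>k. norm (a - of_ga k) < inverse (real (Suc n))" for n
      by (rule of_ga_dense) simp
    then obtain X where X: "norm (a - of_ga (X n)) < inverse (real (Suc n))" for n
      by metis
    have "(\<lambda>n. of_ga (X n) - a) \<longlonglongrightarrow> 0"
      by (rule Lim_null_comparison[OF always_eventually LIMSEQ_inverse_real_of_nat])
         (use X in \<open>simp add: norm_minus_commute less_imp_le\<close>)
    then show ?thesis using that LIM_zero_iff by blast
  qed
  have "d a = 0"
    using bounded_linear.tendsto[OF lin X] by (simp add: d_of_ga LIMSEQ_const_iff)
  then show "f a = h a" by (simp add: d_def)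
qed

lemma group_cstar_map_unitary:
  "Modules.additive \<theta> \<Longrightarrow> group_cstar_map \<theta> (group_unitary g) = group_unitary (\<theta> g)"
  unfolding group_unitary_def
  by transfer (simp add: ga_map_single ga_rel_self ga_cauchy_const)

text \<open>The algebraic identities hold on representatives term by term, and the norm bound is the
  limit of \<open>ga_norm_map_le\<close>.\<close>

lemma star_hom_group_cstar_map:
  assumes \<theta>: "Modules.additive \<theta>"
  shows "star_hom (group_cstar_map \<theta>)"
proof -
  note [simp] = ga_rel_self ga_cauchy_add ga_cauchy_mult ga_cauchy_scale ga_cauchy_star ga_cauchy_map
  have add: "group_cstar_map \<theta> (a + b) = group_cstar_map \<theta> a + group_cstar_map \<theta> b" for a b
    using \<theta> by transfer (simp add: ga_map_add)
  have scale: "group_cstar_map \<theta> (c *\<^sub>C a) = c *\<^sub>C group_cstar_map \<theta> a" for c a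
    using \<theta> by transfer (simp add: ga_map_scale)
  have mult: "group_cstar_map \<theta> (a * b) = group_cstar_map \<theta> a * group_cstar_map \<theta> b" for a b
    using \<theta> by transfer (simp add: ga_map_mult)
  have star: "group_cstar_map \<theta> (star a) = star (group_cstar_map \<theta> a)" for a
    using \<theta> by transfer (simp add: ga_map_star)
  have norm: "norm (group_cstar_map \<theta> a) \<le> norm a" for a
    using \<theta>
  proof transfer
    fix \<theta> :: "'a \<Rightarrow> 'b" and S :: "nat \<Rightarrow> 'a \<Rightarrow>\<^sub>0 complex"
    assume \<theta>: "Modules.additive \<theta>" and S: "ga_rel S S"
    then show "lim (\<lambda>n. ga_norm (if Modules.additive \<theta> then ga_map \<theta> (S n) else 0)) \<le> lim (\<lambda>n. ga_norm (S n))"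
      by (auto intro!: LIMSEQ_le[OF ga_norm_LIMSEQ ga_norm_LIMSEQ] ga_norm_map_le)
  qed
  have "bounded_linear (group_cstar_map \<theta>)"
    by (rule bounded_linear_intro[where K = 1]) (simp_all add: add norm scale flip: scaleC_of_real)
  then show ?thesis
    by (simp add: star_hom_def bounded_clinear_def scale mult star)
qed

text \<open>Resolves the definite description in \<open>induced_hom\<close>: existence by
  construction, uniqueness from the values on the unitaries.\<close>

lemma induced_hom_eq_group_cstar_map:
  assumes "Modules.additive \<theta>"
  shows "induced_hom \<theta> = group_cstar_map \<theta>"
  unfolding induced_hom_def
proof (rule the_equality)
  show "star_hom (group_cstar_map \<theta>) \<and> (\<forall>g. group_cstar_map \<theta> (group_unitary g) = group_unitary (\<theta> g))"
    using assms by (simp add: star_hom_group_cstar_map group_cstar_map_unitary)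
next
  fix \<phi> :: "'a group_cstar \<Rightarrow> 'b group_cstar"
  assume "star_hom \<phi> \<and> (\<forall>g. \<phi> (group_unitary g) = group_unitary (\<theta> g))"
  then show "\<phi> = group_cstar_map \<theta>"
    using star_hom_group_cstar_map[OF assms] group_cstar_map_unitary[OF assms]
    by (intro bounded_clinear_group_cstar_eqI) (auto simp: star_hom_def)
qed

lemma star_hom_induced_hom: "Modules.additive \<theta> \<Longrightarrow> star_hom (induced_hom \<theta>)"
  by (simp add: induced_hom_eq_group_cstar_map star_hom_group_cstar_map)

lemma induced_hom_unitary:
  "Modules.additive \<theta> \<Longrightarrow> induced_hom \<theta> (group_unitary g) = group_unitary (\<theta> g)"
  by (simp add: induced_hom_eq_group_cstar_map group_cstar_map_unitary)

lemma induced_hom_one: "Modules.additive \<theta> \<Longrightarrow> induced_hom \<theta> 1 = 1"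
  by (metis Modules.additive.zero group_unitary_zero induced_hom_unitary)

lemma induced_hom_id: "induced_hom id = id"
proof (rule bounded_clinear_group_cstar_eqI)
  have "Modules.additive (id :: 'a \<Rightarrow> 'a)" by (simp add: Modules.additive_def)
  then show "bounded_clinear (induced_hom (id :: 'a \<Rightarrow> 'a))"
      "induced_hom id (group_unitary g) = id (group_unitary g)" for g :: 'a
    using star_hom_induced_hom by (auto simp: star_hom_def induced_hom_unitary)
  show "bounded_clinear (id :: 'a group_cstar \<Rightarrow> 'a group_cstar)"
    by (simp add: bounded_clinear_def id_def bounded_linear_ident)
qed

text \<open>Comparison on the unitaries suffices. Together with \<open>induced_hom_id\<close>, this
  turns an action on the group into one on its C*-algebra.\<close>

lemma induced_hom_comp:
  assumes "Modules.additive \<theta>" "Modules.additive \<eta>"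
  shows "induced_hom (\<theta> \<circ> \<eta>) = induced_hom \<theta> \<circ> induced_hom \<eta>"
proof (rule bounded_clinear_group_cstar_eqI)
  have comp: "Modules.additive (\<theta> \<circ> \<eta>)" using assms by (simp add: Modules.additive_def)
  show "bounded_clinear (induced_hom (\<theta> \<circ> \<eta>))"
    using star_hom_induced_hom[OF comp] by (simp add: star_hom_def)
  show "bounded_clinear (induced_hom \<theta> \<circ> induced_hom \<eta>)"
    using assms[THEN star_hom_induced_hom]
    by (auto simp: star_hom_def bounded_clinear_def comp_def intro: bounded_linear_compose)
  show "(induced_hom (\<theta> \<circ> \<eta>)) (group_unitary g) = (induced_hom \<theta> \<circ> induced_hom \<eta>) (group_unitary g)" for g
    using assms comp by (simp add: induced_hom_unitary)
qed


section \<open>The twisted system\<close>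

lemma bimodule_iso_trans:
  assumes "bimodule_iso X Y U" "bimodule_iso Y Z V"
  shows "bimodule_iso X Z (V \<circ> U)"
  unfolding bimodule_iso_def
proof (intro conjI)
  have bij: "bij_betw U (hcarrier X) (hcarrier Y)" "bij_betw V (hcarrier Y) (hcarrier Z)"
    using assms by (auto simp: bimodule_iso_def)
  then show "bij_betw (V \<circ> U) (hcarrier X) (hcarrier Z)"
    by (rule bij_betw_trans)
  \<comment> \<open>The equations for \<open>V\<close> are known only on the carrier of
    \<open>Y\<close>.\<close>
  from bij(1) have "\<And>x. x \<in> hcarrier X \<Longrightarrow> U x \<in> hcarrier Y"
    by (rule bij_betwE[rule_format])
  with assms show "(V \<circ> U) (hzero X) = hzero Z"
      "\<forall>x\<in>hcarrier X. \<forall>y\<in>hcarrier X. (V \<circ> U) (hadd X x y) = hadd Z ((V \<circ> U) x) ((V \<circ> U) y)"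
      "\<forall>x\<in>hcarrier X. \<forall>c. (V \<circ> U) (hscale X c x) = hscale Z c ((V \<circ> U) x)"
      "\<forall>x\<in>hcarrier X. \<forall>a. (V \<circ> U) (lact X a x) = lact Z a ((V \<circ> U) x)"
      "\<forall>x\<in>hcarrier X. \<forall>a. (V \<circ> U) (ract X x a) = ract Z ((V \<circ> U) x) a"
      "\<forall>x\<in>hcarrier X. \<forall>y\<in>hcarrier X. hinner Z ((V \<circ> U) x) ((V \<circ> U) y) = hinner X x y"
    by (simp_all add: bimodule_iso_def)
qed

text \<open>Commutativity makes multiplication by \<open>u\<close> compatible with the left action,
  and \<open>u\<close> cancels from \<open>star x * y\<close>, through which alone the inner product
  depends on its arguments. The inverse is multiplication by \<open>star u\<close>.\<close>

lemma bimodule_iso_unitary_mult: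
  fixes u :: "'g::ab_group_add group_cstar"
  assumes "star u * u = 1"
  shows "bimodule_iso (action_fiber \<theta> p) (action_fiber \<theta> p) (lact (action_fiber \<theta> p) u)"
proof -
  have "star u * (u * a) = a" "u * (star u * a) = a" for a
    using assms mult.assoc[of "star u" u a] mult.assoc[of u "star u" a] mult.commute[of u "star u"]
    by simp_all
  moreover from this have "star (u * a) * (u * b) = star a * b" for a b
    by (simp add: star_mult mult.assoc)
  ultimately show ?thesis
    by (auto simp: bimodule_iso_def action_fiber_def scaleC_mult_right algebra_simps
        intro!: bij_betw_byWitness[where f' = "\<lambda>x. (p, star u * snd x)"])
qed

theorem mainTheorem4:
  fixes \<theta> :: "'p::monoid_mult \<Rightarrow> 'g::{ab_group_add, countable} \<Rightarrow> 'g"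
    and \<xi> :: "'p \<Rightarrow> 'p \<Rightarrow> 'g group_cstar"
  assumes "injective_action \<theta>"
    and "product_system (action_system \<theta>)"
    and "\<And>p q. self_adjoint (\<xi> p q)"
    and "normalized_cocycle \<theta> \<xi>"
  shows "product_system (twisted_system \<theta> \<xi>)"
proof -
  interpret X: product_system "action_system \<theta>" by fact
  define u where "u p q = exp (\<i> *\<^sub>C \<xi> p q)" for p q
  have fiber: "fiber (twisted_system \<theta> \<xi>) = fiber (action_system \<theta>)"
    and unit: "unit_emb (twisted_system \<theta> \<xi>) = unit_emb (action_system \<theta>)"
    by (simp_all add: twisted_system_def action_system_def)
  have fiber_action: "fiber (action_system \<theta>) p = action_fiber \<theta> p" for p
    by (simp add: action_system_def)
  have carrier: "hcarrier (action_fiber \<theta> p) = {p} \<times> UNIV" for p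
    by (simp add: action_fiber_def)
  have pmult: "pmult (twisted_system \<theta> \<xi>) (p, a) (q, b) = (p * q, u p q * a * induced_hom (\<theta> p) b)"
    for p q a b
    by (simp add: twisted_system_def u_def)
  \<comment> \<open>In this form the twist can be absorbed into an automorphism of the target
    fibre.\<close>
  have pmult_eq: "pmult (twisted_system \<theta> \<xi>) x y
      = lact (action_fiber \<theta> (p * q)) (u p q) (pmult (action_system \<theta>) x y)"
    if "x \<in> hcarrier (action_fiber \<theta> p)" "y \<in> hcarrier (action_fiber \<theta> q)" for p q x y
    using that by (auto simp: carrier pmult) (simp add: action_system_def action_fiber_def mult.assoc)
  have u_unit: "u p q = 1" if "p = 1 \<or> q = 1" for p q
  proof -
    have "\<xi> p q = 0" using assms(4) that by (auto simp: normalized_cocycle_def)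
    moreover have "\<i> *\<^sub>C (0 :: 'g group_cstar) = 0"
      using scaleC_add_right[of \<i> "0 :: 'g group_cstar" 0] by simp
    ultimately show ?thesis by (simp add: u_def)
  qed
  have u_unitary: "star (u p q) * u p q = 1" for p q
    using assms(3) by (simp add: u_def star_exp_ii exp_minus_inverse mult.commute)
  have additive: "Modules.additive (\<theta> p)" for p
    using assms(1) by (simp add: injective_action_def Modules.additive_def)
  have hom: "star_hom (induced_hom (\<theta> p))" for p
    by (simp add: star_hom_induced_hom additive)
  have hom_mult: "induced_hom (\<theta> p) (a * b) = induced_hom (\<theta> p) a * induced_hom (\<theta> p) b" for p a b
    using hom[of p] by (simp add: star_hom_def)
  have hom_comp: "induced_hom (\<theta> (p * q)) a = induced_hom (\<theta> p) (induced_hom (\<theta> q) a)" for p q a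
    using assms(1) additive by (simp add: injective_action_def induced_hom_comp)
  \<comment> \<open>With the homomorphism moved into the exponent, the additive cocycle identity can
    be exponentiated.\<close>
  have hom_u: "induced_hom (\<theta> p) (u q r) = exp (\<i> *\<^sub>C induced_hom (\<theta> p) (\<xi> q r))" for p q r
    using hom[of p] unfolding u_def star_hom_exp[OF hom induced_hom_one[OF additive]]
    by (simp add: star_hom_def bounded_clinear_def)
  have u_cocycle: "u (p * q) r * u p q = u p (q * r) * induced_hom (\<theta> p) (u q r)" for p q r
  proof -
    have "induced_hom (\<theta> p) (\<xi> q r) - \<xi> (p * q) r + \<xi> p (q * r) - \<xi> p q = 0"
      using assms(4) by (simp add: normalized_cocycle_def)
    then have "\<xi> (p * q) r + \<xi> p q = \<xi> p (q * r) + induced_hom (\<theta> p) (\<xi> q r)"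
      by (simp add: algebra_simps)
    then show ?thesis
      unfolding hom_u unfolding u_def
      by (simp add: exp_add_commuting[symmetric] mult.commute add.commute flip: scaleC_add_right)
  qed
  show ?thesis
  proof (rule product_system.intro, unfold fiber unit)
    fix p q r x y z
    assume x: "x \<in> hcarrier (fiber (action_system \<theta>) p)"
      and y: "y \<in> hcarrier (fiber (action_system \<theta>) q)"
    show "pmult (twisted_system \<theta> \<xi>) x y \<in> hcarrier (fiber (action_system \<theta>) (p * q))"
      using x y by (auto simp: fiber_action carrier pmult)
    assume z: "z \<in> hcarrier (fiber (action_system \<theta>) r)"
    obtain a b c where "x = (p, a)" "y = (q, b)" "z = (r, c)"
      using x y z by (auto simp: fiber_action carrier)
    moreover have "u (p * q) r * (u p q * a * induced_hom (\<theta> p) b) * induced_hom (\<theta> (p * q)) c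
        = u p (q * r) * a * induced_hom (\<theta> p) (u q r * b * induced_hom (\<theta> q) c)"
    proof -
      \<comment> \<open>Gathering the two twisting factors in front exposes the left side of
        \<open>u_cocycle\<close>.\<close>
      have "u (p * q) r * (u p q * a * induced_hom (\<theta> p) b) * induced_hom (\<theta> (p * q)) c
          = (u (p * q) r * u p q) * (a * induced_hom (\<theta> p) b * induced_hom (\<theta> (p * q)) c)"
        by (simp add: mult_ac)
      then show ?thesis
        unfolding u_cocycle by (simp add: hom_comp hom_mult mult_ac)
    qed
    ultimately show "pmult (twisted_system \<theta> \<xi>) (pmult (twisted_system \<theta> \<xi>) x y) z
        = pmult (twisted_system \<theta> \<xi>) x (pmult (twisted_system \<theta> \<xi>) y z)"
      by (simp add: pmult mult.assoc[of p q r])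
  next
    fix p q :: 'p
    assume "p \<noteq> 1" "q \<noteq> 1"
    then obtain U where U: "bimodule_iso (tensor_bimodule (action_fiber \<theta> p) (action_fiber \<theta> q))
          (action_fiber \<theta> (p * q)) U"
        "\<And>x y. x \<in> hcarrier (action_fiber \<theta> p) \<Longrightarrow> y \<in> hcarrier (action_fiber \<theta> q) \<Longrightarrow>
          U (elem_tensor (action_fiber \<theta> p) (action_fiber \<theta> q) x y) = pmult (action_system \<theta>) x y"
      using X.mult_tensor unfolding fiber_action by blast
    show "\<exists>U. bimodule_iso (tensor_bimodule (fiber (action_system \<theta>) p) (fiber (action_system \<theta>) q))
          (fiber (action_system \<theta>) (p * q)) U \<and>
        (\<forall>x\<in>hcarrier (fiber (action_system \<theta>) p). \<forall>y\<in>hcarrier (fiber (action_system \<theta>) q).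
          U (elem_tensor (fiber (action_system \<theta>) p) (fiber (action_system \<theta>) q) x y)
            = pmult (twisted_system \<theta> \<xi>) x y)"
      unfolding fiber_action
      \<comment> \<open>On elementary tensors this composite is the twisted product by
        \<open>pmult_eq\<close>.\<close>
      by (intro exI[of _ "lact (action_fiber \<theta> (p * q)) (u p q) \<circ> U"] conjI
          bimodule_iso_trans[OF U(1) bimodule_iso_unitary_mult[OF u_unitary]])
         (auto simp: U(2) pmult_eq)
  next
    fix x p a
    assume x: "x \<in> hcarrier (fiber (action_system \<theta>) p)"
    then obtain b where b: "x = (p, b)" by (auto simp: fiber_action carrier)
    have emb: "unit_emb (action_system \<theta>) a = (1, a)" by (simp add: action_system_def)
    \<comment> \<open>Normalization removes the twist, and \<open>\<theta> 1 = id\<close> induces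
      the identity on the coefficients.\<close>
    show "pmult (twisted_system \<theta> \<xi>) (unit_emb (action_system \<theta>) a) x = lact (fiber (action_system \<theta>) p) a x"
      using assms(1)
      by (simp add: b emb pmult u_unit fiber_action action_fiber_def injective_action_def induced_hom_id)
    show "pmult (twisted_system \<theta> \<xi>) x (unit_emb (action_system \<theta>) a) = ract (fiber (action_system \<theta>) p) x a"
      by (simp add: b emb pmult u_unit fiber_action action_fiber_def)
  \<comment> \<open>The remaining axioms do not involve the multiplication and are
    inherited.\<close>
  qed (fact X.disjoint X.fiber_bimodule X.unit_fiber)+
qed

end
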